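(* Let $a<b$ and let $\omega\in\mathcal{S}[a,b]$ be a smooth diagram with center $z(\omega)=a+\omega(a)$. Then: (2a) $$\pi=\int_a^b\left[\cos\!\left(\frac{\pi\omega'(x)}{2}\right)(x-a)^{-(1+\omega'(x))/2}(b-x)^{-(1-\omega'(x))/2}\exp\left(\frac12\int_a^b\frac{\omega'(u)-\omega'(x)}{u-x}\,du\right)\right]dx.$$ (2b) $$\int_a^b(\omega(x)-|x-z(\omega)|)\,dx=\int_a^b\left[\frac{2}{\pi}\cos\!\left(\frac{\pi\omega'(x)}{2}\right)(x-a)^{(1+\omega'(x))/2}(b-x)^{(1-\omega'(x))/2}\exp\left(-\frac12\int_a^b\frac{\omega'(u)-\omega'(x)}{u-x}\,du\right)\right]dx.$$
   Context: A diagram on $[a,b]$ is a 1-Lipschitz function $\omega:[a,b]\to\mathbb{R}$ with $a+\omega(a)=b-\omega(b)$; its center is $z(\omega)=a+\omega(a)$. $\mathcal{S}[a,b]$ is the set of diagrams $\omega$ on $[a,b]$ that are piecewise twice continuously differentiable, with $\omega''$ bounded, and such that for some constants $-1<c_1<c_2<1$ one has $c_1<\omega'(x)<c_2$ wherever $\omega'$ is defined. *)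

theory Defs
  imports "HOL-Analysis.Analysis"
begin

text \<open>
  A function on [a,b] is a total function of type \<^typ>\<open>real \<Rightarrow> real\<close> whose values outside [a,b]
  carry no meaning. Derivatives are therefore only constrained at interior points, where
  \<^const>\<open>deriv\<close> depends only on the restriction to [a,b].
\<close>

definition diagram :: "real \<Rightarrow> real \<Rightarrow> (real \<Rightarrow> real) \<Rightarrow> bool" where
  "diagram a b \<omega> \<longleftrightarrow> 1-lipschitz_on {a..b} \<omega> \<and> a + \<omega> a = b - \<omega> b"

definition diagram_center :: "real \<Rightarrow> (real \<Rightarrow> real) \<Rightarrow> real" where
  "diagram_center a \<omega> = a + \<omega> a"

text \<open>
  The finite set \<open>K\<close> consists of the interior breakpoints, so the pieces are the components of the
  open set \<open>{a<..<b} - K\<close>. One-sided second derivatives at the breakpoints are not required to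
  exist; for this reason boundedness of the second derivative is a separate condition.
\<close>

definition C2_off :: "real \<Rightarrow> real \<Rightarrow> real set \<Rightarrow> (real \<Rightarrow> real) \<Rightarrow> bool" where
  "C2_off a b K f \<longleftrightarrow>
     (\<forall>x\<in>{a<..<b} - K. f differentiable (at x) \<and> deriv f differentiable (at x)) \<and>
     continuous_on ({a<..<b} - K) (deriv (deriv f))"

text \<open>
  The slope condition ranges over every interior point where the derivative exists, including
  such points of \<open>K\<close>.
\<close>

definition smooth_diagrams :: "real \<Rightarrow> real \<Rightarrow> (real \<Rightarrow> real) set" where
  "smooth_diagrams a b = {\<omega>. diagram a b \<omega> \<and>
     (\<exists>K. finite K \<and> C2_off a b K \<omega> \<and> bounded (deriv (deriv \<omega>) ` ({a<..<b} - K))) \<and>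
     (\<exists>c\<^sub>1 c\<^sub>2. -1 < c\<^sub>1 \<and> c\<^sub>1 < c\<^sub>2 \<and> c\<^sub>2 < 1 \<and>
        (\<forall>x\<in>{a<..<b}. \<omega> differentiable (at x) \<longrightarrow> c\<^sub>1 < deriv \<omega> x \<and> deriv \<omega> x < c\<^sub>2))}"

end

theory Submission
  imports Defs "HOL-Complex_Analysis.Complex_Analysis" "HOL-Real_Asymp.Real_Asymp"
begin

text \<open>
  The generating function \<open>G z = ((z - a) (z - b))\<^bsup>-1/2\<^esup> exp (1/2 \<integral> \<omega>' u / (u - z) du)\<close> of the transition
  measure is holomorphic off \<open>[a, b]\<close>. Put \<open>m = (a + b) / 2\<close>, \<open>r = (b - a) / 2\<close>. The Joukowski map
  \<open>z = m - r/2 (w + 1/w)\<close> sends the unit disc onto the complement of \<open>[a, b]\<close> and the boundary point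
  \<open>w = exp (i \<alpha>)\<close> to \<open>x = m - r cos \<alpha>\<close>. In the variable \<open>w\<close> the exponent of \<open>G\<close> becomes the power
  series \<open>E w = \<Sum>s\<^sub>n w\<^sup>n\<close>, where \<open>s\<^sub>n\<close> is the integral of \<open>\<omega>' x sin (n \<alpha>)\<close> over \<open>0 \<le> \<alpha> \<le> \<pi>\<close>. The integrand of
  (2a) times \<open>dx / d\<alpha>\<close> is \<open>Re (exp E)\<close> on the unit circle, so that (2a) is the mean value property
  \<open>exp (E 0) = 1\<close>. Likewise (2b) reads off the coefficient of \<open>w\<^sup>2\<close> in \<open>- (1 - w\<^sup>2)\<^sup>2 / 4 exp (- E w)\<close>,
  which is \<open>1/2 - s\<^sub>1\<^sup>2 / 8 + s\<^sub>2 / 4\<close>, and \<open>s\<^sub>1\<close>, \<open>s\<^sub>2\<close> are moments of \<open>\<omega>'\<close> that integration by parts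
  evaluates. The passage to the boundary needs only \<open>\<bar>\<omega>'\<bar> \<le> c < 1\<close>, which gives \<open>\<bar>Im E\<bar> \<le> c \<pi> / 2\<close>.
\<close>

section \<open>The kernel of the exponent\<close>

text \<open>A measure of its own rather than set integrals over \<open>{0..pi}\<close>, so that
  general facts on finite measures apply. The angle parametrises both the upper unit semicircle and,
  later, the interval \<open>[a, b]\<close>.\<close>

definition half_circle :: "real measure" where
  "half_circle = restrict_space lborel {0..pi}"

lemma space_half_circle [simp]: "space half_circle = {0..pi}"
  by (simp add: half_circle_def space_restrict_space)

interpretation half_circle: finite_measure half_circle
  by standard (simp add: half_circle_def emeasure_restrict_space space_restrict_space)

lemma measure_half_circle [simp]: "measure half_circle {0..pi} = pi"
  by (simp add: half_circle_def measure_restrict_space)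

lemma half_circle_measurable [measurable (raw)]:
  "f \<in> borel_measurable borel \<Longrightarrow> f \<in> borel_measurable half_circle"
  by (simp add: half_circle_def measurable_restrict_space1)

lemma half_circle_continuous_measurable:
  "continuous_on {0..pi} f \<Longrightarrow> f \<in> borel_measurable half_circle"
  unfolding half_circle_def
  using borel_measurable_continuous_on_restrict[of "{0..pi}" f]
  by (simp cong: measurable_cong_sets sets_restrict_space_cong)

lemma integral_half_circle:
  fixes f :: "real \<Rightarrow> 'a::{banach, second_countable_topology}"
  shows "integral\<^sup>L half_circle f = (LBINT \<beta>:{0..pi}. f \<beta>)"
  by (simp add: half_circle_def integral_restrict_space set_lebesgue_integral_def)

lemma integrable_half_circle:
  fixes f :: "real \<Rightarrow> 'a::{banach, second_countable_topology}"
  shows "integrable half_circle f \<longleftrightarrow> set_integrable lborel {0..pi} f"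
  by (simp add: half_circle_def integrable_restrict_space set_integrable_def)

lemma AE_half_circle_interior:
  "AE \<alpha> in half_circle. 0 < \<alpha> \<and> \<alpha> < pi"
proof -
  have "AE \<alpha> in lborel. \<alpha> \<noteq> 0 \<and> \<alpha> \<noteq> pi"
    by (intro AE_conjI AE_lborel_singleton)
  then have "AE \<alpha> in lborel. \<alpha> \<in> {0..pi} \<longrightarrow> 0 < \<alpha> \<and> \<alpha> < pi"
    by eventually_elim auto
  then show ?thesis
    unfolding half_circle_def by (subst AE_restrict_space_iff) auto
qed

text \<open>This is \<open>du / (2 (u - z))\<close> in the disc variable: with
  \<open>z = m - r/2 (w + 1/w)\<close> and \<open>u = m - r cos \<beta>\<close> one has
  \<open>u - z = r (1 - 2 w cos \<beta> + w^2) / (2 w)\<close> and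
  \<open>du = r sin \<beta> d\<beta>\<close>.\<close>

definition kern :: "real \<Rightarrow> complex \<Rightarrow> complex" where
  "kern \<beta> w = w * sin \<beta> / (1 - 2 * w * cos \<beta> + w\<^sup>2)"

lemma kern_denominator:
  fixes w :: complex and \<beta> :: real
  shows "1 - 2 * w * cos \<beta> + w\<^sup>2 = (1 - w * cis \<beta>) * (1 - w * cis (-\<beta>))"
proof -
  have "(1 - w * cis \<beta>) * (1 - w * cis (-\<beta>)) = 1 - w * (cis \<beta> + cis (-\<beta>)) + w\<^sup>2 * (cis \<beta> * cis (-\<beta>))"
    by (simp add: algebra_simps power2_eq_square)
  also have "cis \<beta> + cis (-\<beta>) = 2 * cos \<beta>"
    by (simp add: complex_eq_iff)
  also have "cis \<beta> * cis (-\<beta>) = 1"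
    by (simp add: cis_mult)
  finally show ?thesis by (simp add: algebra_simps)
qed

lemma one_minus_cis_nonzero: "norm w < 1 \<Longrightarrow> 1 - w * cis \<beta> \<noteq> 0"
  by (metis eq_iff_diff_eq_0 less_irrefl norm_cis norm_mult mult.right_neutral norm_one)

lemma kern_denominator_nonzero:
  fixes w :: complex and \<beta> :: real
  shows "norm w < 1 \<Longrightarrow> 1 - 2 * w * cos \<beta> + w\<^sup>2 \<noteq> 0"
  unfolding kern_denominator using one_minus_cis_nonzero[of w \<beta>] one_minus_cis_nonzero[of w "-\<beta>"]
  by (metis mult_eq_0_iff)

text \<open>Each term is a geometric series in \<open>w\<close> and, up to a constant multiple and
  an additive constant, a logarithmic derivative in \<beta>. The first view gives
  \<open>kern_sums\<close>, the second \<open>integral_kern\<close>.\<close>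

lemma kern_partial_fractions:
  assumes "norm w < 1"
  shows "kern \<beta> w = (1 / (1 - w * cis \<beta>) - 1 / (1 - w * cis (-\<beta>))) / (2 * \<i>)"
proof -
  define P Q where "P = 1 - w * cis \<beta>" and "Q = 1 - w * cis (-\<beta>)"
  have "w * sin \<beta> = (Q - P) / (2 * \<i>)"
    by (simp add: P_def Q_def complex_eq_iff)
  moreover have "P \<noteq> 0" "Q \<noteq> 0"
    unfolding P_def Q_def by (intro one_minus_cis_nonzero assms)+
  ultimately show ?thesis
    unfolding kern_def kern_denominator P_def[symmetric] Q_def[symmetric]
    by (simp add: field_simps)
qed

lemma kern_sums:
  assumes "norm w < 1"
  shows "(\<lambda>n. of_real (sin (real n * \<beta>)) * w ^ n) sums kern \<beta> w"
proof -
  have *: "(\<lambda>n. (w * cis \<gamma>) ^ n) sums (1 / (1 - w * cis \<gamma>))" for \<gamma>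
    using assms by (intro geometric_sums) (simp add: norm_mult)
  have "(\<lambda>n. ((w * cis \<beta>) ^ n - (w * cis (-\<beta>)) ^ n) / (2 * \<i>)) sums kern \<beta> w"
    unfolding kern_partial_fractions[OF assms] by (intro sums_divide sums_diff *)
  also have "(\<lambda>n. ((w * cis \<beta>) ^ n - (w * cis (-\<beta>)) ^ n) / (2 * \<i>)) =
             (\<lambda>n. of_real (sin (real n * \<beta>)) * w ^ n)"
  proof
    fix n
    have "cis (real n * \<beta>) - cis (real n * (-\<beta>)) = 2 * \<i> * sin (real n * \<beta>)"
      by (simp add: complex_eq_iff)
    moreover have "(w * cis \<beta>) ^ n - (w * cis (-\<beta>)) ^ n = w ^ n * (cis (real n * \<beta>) - cis (real n * (-\<beta>)))"
      by (simp only: power_mult_distrib Complex.DeMoivre right_diff_distrib)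
    ultimately show "((w * cis \<beta>) ^ n - (w * cis (-\<beta>)) ^ n) / (2 * \<i>) = of_real (sin (real n * \<beta>)) * w ^ n"
      by (subst divide_eq_eq) (simp add: mult_ac)
  qed
  finally show ?thesis .
qed

lemma kern_cnj: "kern \<beta> (cnj w) = cnj (kern \<beta> w)"
  by (simp add: kern_def)

lemma continuous_on_kern:
  "norm w < 1 \<Longrightarrow> continuous_on A (\<lambda>\<beta>. kern \<beta> w)"
  unfolding kern_def by (intro continuous_intros ballI kern_denominator_nonzero)

lemma kern_measurable [measurable]: "(\<lambda>\<beta>. kern \<beta> w) \<in> borel_measurable borel"
  unfolding kern_def by measurable

lemma half_circle_integrable_kern: "norm w < 1 \<Longrightarrow> integrable half_circle (\<lambda>\<beta>. kern \<beta> w)"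
  unfolding integrable_half_circle
  by (intro borel_integrable_atLeastAtMost' continuous_on_kern)

text \<open>Expanding the quotient by the conjugate denominator leaves \<open>Im w\<close> times a
  nonnegative factor. The sign is therefore the same for all \<beta>, which later turns an L1 norm
  into the modulus of an explicit integral.\<close>

lemma sgn_Im_kern:
  assumes "norm w < 1" "\<beta> \<in> {0..pi}"
  shows "0 \<le> Im w \<Longrightarrow> 0 \<le> Im (kern \<beta> w)" and "Im w \<le> 0 \<Longrightarrow> Im (kern \<beta> w) \<le> 0"
proof -
  define D where "D = 1 - 2 * w * cos \<beta> + w\<^sup>2"
  have "Im (w * cnj D) = Im w * (1 - (norm w)\<^sup>2)"
    unfolding D_def cmod_power2 by (simp add: power2_eq_square algebra_simps)
  moreover have "kern \<beta> w = of_real (sin \<beta> / (norm D)\<^sup>2) * (w * cnj D)"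
    unfolding kern_def D_def[symmetric] by (simp add: complex_div_cnj[of _ D])
  ultimately have eq: "Im (kern \<beta> w) = sin \<beta> / (norm D)\<^sup>2 * (1 - (norm w)\<^sup>2) * Im w"
    by simp
  have "(norm w)\<^sup>2 \<le> 1" using assms by (simp add: power_le_one)
  then have "0 \<le> sin \<beta> / (norm D)\<^sup>2 * (1 - (norm w)\<^sup>2)"
    using assms by (simp add: sin_ge_zero)
  then show "0 \<le> Im w \<Longrightarrow> 0 \<le> Im (kern \<beta> w)" and "Im w \<le> 0 \<Longrightarrow> Im (kern \<beta> w) \<le> 0"
    unfolding eq by (blast intro: mult_nonneg_nonneg mult_nonneg_nonpos)+
qed

lemma integral_kern:
  assumes "norm w < 1"
  shows "(\<integral>\<beta>. kern \<beta> w \<partial>half_circle) = Ln ((1 + w) / (1 - w))"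
proof -
  have pos: "0 < Re (1 - w * cis \<gamma>)" for \<gamma>
  proof -
    have "Re (w * cis \<gamma>) \<le> norm (w * cis \<gamma>)" by (rule complex_Re_le_cmod)
    also have "\<dots> = norm w" by (simp add: norm_mult)
    finally show ?thesis using assms by simp
  qed
  then have nn: "1 - w * cis \<gamma> \<notin> \<real>\<^sub>\<le>\<^sub>0" for \<gamma>
    by (metis complex_nonpos_Reals_iff not_less)
  \<comment> \<open>Formally half the logarithm of the denominator. Keeping the two factors separate
    keeps each argument in the right half-plane, where \<open>Ln\<close> is differentiable.\<close>
  define F where "F = (\<lambda>\<beta>. (Ln (1 - w * cis \<beta>) + Ln (1 - w * cis (-\<beta>))) / 2)"
  have D: "(F has_vector_derivative kern \<beta> w) (at \<beta> within {0..pi})" for \<beta>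
  proof -
    have "((\<lambda>\<beta>. Ln (1 - w * cis (s * \<beta>))) has_vector_derivative
        (- (w * (s * \<i> * cis (s * \<beta>)))) * (1 / (1 - w * cis (s * \<beta>)))) (at \<beta> within {0..pi})" for s :: real
    proof -
      have "((\<lambda>\<beta>. cis (s * \<beta>)) has_vector_derivative s * \<i> * cis (s * \<beta>)) (at \<beta> within {0..pi})"
        unfolding has_vector_derivative_def
        by (auto intro!: derivative_eq_intros simp: scaleR_conv_of_real)
      then have 1: "((\<lambda>\<beta>. 1 - w * cis (s * \<beta>)) has_vector_derivative - (w * (s * \<i> * cis (s * \<beta>))))
          (at \<beta> within {0..pi})"
        by (auto intro!: derivative_eq_intros)
      have 2: "(Ln has_field_derivative 1 / (1 - w * cis (s * \<beta>))) (at (1 - w * cis (s * \<beta>)) within UNIV)"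
        using has_field_derivative_Ln[OF nn] by (simp add: inverse_eq_divide)
      show ?thesis
        using field_vector_diff_chain_within[OF 1 has_field_derivative_subset[OF 2]] by (simp add: o_def)
    qed
    from this[of 1] this[of "-1"]
    have "(F has_vector_derivative ((- (w * (\<i> * cis \<beta>))) * (1 / (1 - w * cis \<beta>)) +
        (w * (\<i> * cis (-\<beta>))) * (1 / (1 - w * cis (-\<beta>)))) / 2) (at \<beta> within {0..pi})"
      unfolding F_def by (auto intro!: derivative_eq_intros)
    also have "((- (w * (\<i> * cis \<beta>))) * (1 / (1 - w * cis \<beta>)) +
        (w * (\<i> * cis (-\<beta>))) * (1 / (1 - w * cis (-\<beta>)))) / 2 = kern \<beta> w"
      unfolding kern_partial_fractions[OF assms]
      using one_minus_cis_nonzero[OF assms, of \<beta>] one_minus_cis_nonzero[OF assms, of "-\<beta>"]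
      by (simp add: divide_simps) (simp add: algebra_simps)
    finally show ?thesis .
  qed
  have "(\<integral>\<beta>. kern \<beta> w \<partial>half_circle) = F pi - F 0"
    unfolding integral_half_circle set_lebesgue_integral_def
    by (rule integral_FTC_atLeastAtMost) (use D continuous_on_kern[OF assms] in auto)
  also have "\<dots> = Ln (1 + w) - Ln (1 - w)"
    by (simp add: F_def cis_pi flip: cis_cnj)
  \<comment> \<open>Both imaginary parts are below \<open>pi / 2\<close> in modulus, so their
    difference stays in the principal strip.\<close>
  also have "\<dots> = Ln ((1 + w) / (1 - w))"
  proof -
    have "0 < Re (1 + w)" "0 < Re (1 - w)"
      using pos[of pi] pos[of 0] by auto
    moreover from this have "1 + w \<noteq> 0" "1 - w \<noteq> 0"
      by (metis less_irrefl zero_complex.sel(1))+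
    ultimately have "\<bar>Im (Ln (1 + w))\<bar> < pi / 2" "\<bar>Im (Ln (1 - w))\<bar> < pi / 2" "1 + w \<noteq> 0" "1 - w \<noteq> 0"
      using Re_Ln_pos_lt_imp[of "1 + w"] Re_Ln_pos_lt_imp[of "1 - w"] by auto
    then show ?thesis
      by (intro Ln_unique[symmetric]) (auto simp: exp_diff)
  qed
  finally show ?thesis .
qed

section \<open>The exponent as a power series\<close>

definition exponent :: "(real \<Rightarrow> real) \<Rightarrow> complex \<Rightarrow> complex" where
  "exponent h w = (\<integral>\<beta>. of_real (h \<beta>) * kern \<beta> w \<partial>half_circle)"

lemma exponent_uminus: "exponent (\<lambda>\<beta>. - h \<beta>) w = - exponent h w"
  by (simp add: exponent_def)

text \<open>The symmetry that folds means over the full circle into means over the upper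
  half.\<close>

lemma exponent_cnj: "exponent h (cnj w) = cnj (exponent h w)"
proof -
  have "(\<lambda>\<beta>. of_real (h \<beta>) * kern \<beta> (cnj w)) = (\<lambda>\<beta>. cnj (of_real (h \<beta>) * kern \<beta> w))"
    by (simp add: kern_cnj)
  then show ?thesis
    unfolding exponent_def by (simp only: Bochner_Integration.integral_cnj)
qed

text \<open>Here \<open>h\<close> is the slope as a function of the angle. The bound is asked for at
  every real number, which is arranged by extending the slope by zero. The gap between
  \<open>c\<close> and 1 drives the passage to the boundary.\<close>

locale bounded_slope =
  fixes h :: "real \<Rightarrow> real" and c :: real
  assumes slope_measurable [measurable]: "h \<in> borel_measurable borel"
    and slope_bound: "\<bar>h \<beta>\<bar> \<le> c"
    and bound_less_1: "c < 1"
begin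

lemma bound_nonneg: "0 \<le> c"
  using slope_bound[of 0] by linarith

lemma bounded_slope_uminus: "bounded_slope (\<lambda>\<beta>. - h \<beta>) c"
  by standard (use slope_bound bound_less_1 in auto)

definition sine_coeff :: "nat \<Rightarrow> real" where
  "sine_coeff n = (\<integral>\<beta>. h \<beta> * sin (real n * \<beta>) \<partial>half_circle)"

lemma integrable_slope_times:
  fixes f :: "real \<Rightarrow> 'a::{real_normed_field, banach, second_countable_topology}"
  assumes "integrable half_circle f"
  shows "integrable half_circle (\<lambda>\<beta>. of_real (h \<beta>) * f \<beta>)"
proof (rule Bochner_Integration.integrable_bound[OF integrable_scaleR_right[OF assms, of c]])
  show "(\<lambda>\<beta>. of_real (h \<beta>) * f \<beta>) \<in> borel_measurable half_circle"
    using assms by measurable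
  show "AE \<beta> in half_circle. norm (of_real (h \<beta>) * f \<beta>) \<le> norm (c *\<^sub>R f \<beta>)"
  proof (rule AE_I2)
    fix \<beta>
    have "\<bar>h \<beta>\<bar> * norm (f \<beta>) \<le> \<bar>c\<bar> * norm (f \<beta>)"
      by (rule mult_right_mono) (use slope_bound[of \<beta>] in auto)
    then show "norm (of_real (h \<beta>) * f \<beta>) \<le> norm (c *\<^sub>R f \<beta>)"
      by (simp add: norm_mult)
  qed
qed

text \<open>Since \<open>\<bar>h \<beta>\<bar> \<le> 1\<close>, the terms of the series for the
  kernel are dominated by \<open>norm w ^ n\<close> uniformly in \<beta>, so sum and integral may be
  interchanged.\<close>

lemma exponent_sums:
  assumes "norm w < 1"
  shows "(\<lambda>n. of_real (sine_coeff n) * w ^ n) sums exponent h w"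
proof -
  define f where "f = (\<lambda>n \<beta>. of_real (h \<beta>) * (of_real (sin (real n * \<beta>)) * w ^ n))"
  have le: "norm (f n \<beta>) \<le> norm w ^ n" for n \<beta>
  proof -
    have "\<bar>h \<beta>\<bar> \<le> 1" using slope_bound[of \<beta>] bound_less_1 by linarith
    then have "\<bar>h \<beta>\<bar> * (\<bar>sin (real n * \<beta>)\<bar> * norm w ^ n) \<le> 1 * (1 * norm w ^ n)"
      by (intro mult_mono) auto
    then show ?thesis by (simp add: f_def norm_mult norm_power)
  qed
  have summ: "summable (\<lambda>n. norm (f n \<beta>))" for \<beta>
    by (rule summable_comparison_test'[of "\<lambda>n. norm w ^ n" 0]) (use assms le in \<open>auto simp: summable_geometric\<close>)
  have int: "integrable half_circle (f n)" for n
    by (rule half_circle.integrable_const_bound[of _ "norm w ^ n"]) (use le in \<open>auto simp: f_def\<close>)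
  have "(\<lambda>n. integral\<^sup>L half_circle (f n)) sums (\<integral>\<beta>. (\<Sum>n. f n \<beta>) \<partial>half_circle)"
  proof (rule sums_integral[OF int])
    show "AE \<beta> in half_circle. summable (\<lambda>n. norm (f n \<beta>))" using summ by simp
    show "summable (\<lambda>n. \<integral>\<beta>. norm (f n \<beta>) \<partial>half_circle)"
    proof (rule summable_comparison_test'[of "\<lambda>n. pi * norm w ^ n" 0])
      show "summable (\<lambda>n. pi * norm w ^ n)" using assms by (intro summable_mult summable_geometric) auto
      fix n
      have "(\<integral>\<beta>. norm (f n \<beta>) \<partial>half_circle) \<le> (\<integral>\<beta>. norm w ^ n \<partial>half_circle)"
        by (intro integral_mono int integrable_norm) (use le in auto)
      then show "norm (\<integral>\<beta>. norm (f n \<beta>) \<partial>half_circle) \<le> pi * norm w ^ n"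
        by simp
    qed
  qed
  also have "(\<lambda>\<beta>. \<Sum>n. f n \<beta>) = (\<lambda>\<beta>. of_real (h \<beta>) * kern \<beta> w)"
    unfolding f_def by (intro ext sums_unique[symmetric] sums_mult kern_sums assms)
  also have "(\<lambda>n. integral\<^sup>L half_circle (f n)) = (\<lambda>n. of_real (sine_coeff n) * w ^ n)"
  proof
    fix n
    have "f n = (\<lambda>\<beta>. of_real (h \<beta> * sin (real n * \<beta>)) * w ^ n)"
      by (simp add: f_def mult.assoc)
    then have "integral\<^sup>L half_circle (f n) = (\<integral>\<beta>. of_real (h \<beta> * sin (real n * \<beta>)) \<partial>half_circle) * w ^ n"
      by (simp only: integral_mult_left_zero)
    then show "integral\<^sup>L half_circle (f n) = of_real (sine_coeff n) * w ^ n"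
      by (simp only: sine_coeff_def integral_complex_of_real)
  qed
  finally show ?thesis unfolding exponent_def .
qed

lemma exponent_holomorphic: "exponent h holomorphic_on ball 0 1"
  by (rule power_series_holomorphic[of _ _ "\<lambda>n. of_real (sine_coeff n)"]) (use exponent_sums in auto)

lemma exponent_0: "exponent h 0 = 0"
  by (simp add: exponent_def kern_def)

text \<open>Prepares the coefficient extraction by formal power series. Convergence at the single
  point 1/2 already makes the radius positive.\<close>

lemma exponent_has_fps_expansion:
  "exponent h has_fps_expansion Abs_fps (\<lambda>n. of_real (sine_coeff n))"
proof -
  show ?thesis
    unfolding has_fps_expansion_def
  proof
    show "0 < fps_conv_radius (Abs_fps (\<lambda>n. complex_of_real (sine_coeff n)))"
    proof -
      have "summable (\<lambda>n. fps_nth (Abs_fps (\<lambda>n. complex_of_real (sine_coeff n))) n * (1/2) ^ n)"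
        using exponent_sums[of "1/2"] by (simp add: sums_summable)
      then have "ereal (norm (1/2::complex)) \<le> fps_conv_radius (Abs_fps (\<lambda>n. complex_of_real (sine_coeff n)))"
        unfolding fps_conv_radius_def by (intro conv_radius_geI)
      then show ?thesis by (rule less_le_trans[rotated]) simp
    qed
    have "\<forall>\<^sub>F z in nhds 0. z \<in> ball (0::complex) 1"
      by (intro eventually_nhds_in_open) auto
    then show "\<forall>\<^sub>F z in nhds 0. eval_fps (Abs_fps (\<lambda>n. complex_of_real (sine_coeff n))) z = exponent h z"
      by eventually_elim (auto simp: eval_fps_def intro!: sums_unique[symmetric] exponent_sums)
  qed
qed

text \<open>As \<open>Im (kern \<beta> w)\<close> keeps its sign in \<beta>, its L1 norm is the
  modulus of \<open>Im (Ln ((1 + w) / (1 - w)))\<close>. The Cayley transform maps the disc into the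
  right half-plane, so this is at most \<open>pi / 2\<close>, and the slope contributes the factor
  \<open>c\<close>.\<close>

lemma Im_exponent_bound:
  assumes "norm w < 1"
  shows "\<bar>Im (exponent h w)\<bar> \<le> c * pi / 2"
proof -
  have int: "integrable half_circle (\<lambda>\<beta>. kern \<beta> w)"
    by (rule half_circle_integrable_kern[OF assms])
  then have intIm: "integrable half_circle (\<lambda>\<beta>. Im (kern \<beta> w))"
    by (rule integrable_Im)
  have "\<bar>Im (exponent h w)\<bar> = \<bar>\<integral>\<beta>. Im (of_real (h \<beta>) * kern \<beta> w) \<partial>half_circle\<bar>"
    unfolding exponent_def by (subst integral_Im) (auto intro: integrable_slope_times int)
  also have "\<dots> \<le> (\<integral>\<beta>. \<bar>h \<beta> * Im (kern \<beta> w)\<bar> \<partial>half_circle)"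
    by (simp add: integral_abs_bound)
  also have "\<dots> \<le> (\<integral>\<beta>. c * \<bar>Im (kern \<beta> w)\<bar> \<partial>half_circle)"
    using intIm integrable_slope_times[OF intIm]
    by (intro integral_mono integrable_mult_right integrable_abs)
       (auto simp: abs_mult intro!: mult_right_mono slope_bound)
  also have "\<dots> = c * (\<integral>\<beta>. \<bar>Im (kern \<beta> w)\<bar> \<partial>half_circle)"
    by simp
  also have "(\<integral>\<beta>. \<bar>Im (kern \<beta> w)\<bar> \<partial>half_circle) = \<bar>\<integral>\<beta>. Im (kern \<beta> w) \<partial>half_circle\<bar>"
  proof (cases "0 \<le> Im w")
    case True
    then have "\<bar>Im (kern \<beta> w)\<bar> = Im (kern \<beta> w)" if "\<beta> \<in> {0..pi}" for \<beta>
      using sgn_Im_kern(1)[OF assms that] by simp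
    then have "(\<integral>\<beta>. \<bar>Im (kern \<beta> w)\<bar> \<partial>half_circle) = (\<integral>\<beta>. Im (kern \<beta> w) \<partial>half_circle)"
      by (intro Bochner_Integration.integral_cong) auto
    moreover have "0 \<le> (\<integral>\<beta>. Im (kern \<beta> w) \<partial>half_circle)"
      using sgn_Im_kern(1)[OF assms] True by (intro integral_nonneg_AE AE_I2) auto
    ultimately show ?thesis by simp
  next
    case False
    then have "\<bar>Im (kern \<beta> w)\<bar> = - Im (kern \<beta> w)" if "\<beta> \<in> {0..pi}" for \<beta>
      using sgn_Im_kern(2)[OF assms that] by simp
    then have "(\<integral>\<beta>. \<bar>Im (kern \<beta> w)\<bar> \<partial>half_circle) = - (\<integral>\<beta>. Im (kern \<beta> w) \<partial>half_circle)"
      by (subst integral_minus[symmetric]) (intro Bochner_Integration.integral_cong, auto)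
    moreover have "0 \<le> (\<integral>\<beta>. - Im (kern \<beta> w) \<partial>half_circle)"
      using sgn_Im_kern(2)[OF assms] False by (intro integral_nonneg_AE AE_I2) auto
    ultimately show ?thesis by simp
  qed
  also have "(\<integral>\<beta>. Im (kern \<beta> w) \<partial>half_circle) = Im (Ln ((1 + w) / (1 - w)))"
    by (simp add: Bochner_Integration.integral_Im[OF int] integral_kern[OF assms])
  also have "\<bar>Im (Ln ((1 + w) / (1 - w)))\<bar> \<le> pi / 2"
  proof (rule less_imp_le, rule Re_Ln_pos_lt_imp)
    have "w \<noteq> 1" using assms by auto
    have "(Re w)\<^sup>2 + (Im w)\<^sup>2 < 1"
      using assms by (metis abs_square_less_1 abs_norm_cancel cmod_power2)
    then have "0 < Re ((1 + w) * cnj (1 - w))"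
      by (simp add: power2_eq_square algebra_simps)
    then have "0 < Re ((1 + w) * cnj (1 - w) / of_real ((norm (1 - w))\<^sup>2))"
      using \<open>w \<noteq> 1\<close> by (simp only: Re_divide_of_real) (auto intro!: divide_pos_pos)
    then show "0 < Re ((1 + w) / (1 - w))"
      by (simp add: complex_div_cnj[of _ "1 - w"])
  qed
  finally show ?thesis
    using bound_nonneg by (simp add: mult_left_mono)
qed

end

section \<open>Taylor coefficients as means over the half circle\<close>

text \<open>Cauchy's formula for the \<open>k\<close>-th derivative gives the mean over the full
  circle; conjugation symmetry makes the real parts on the two halves agree.\<close>

lemma half_circle_mean_value:
  fixes F :: "complex \<Rightarrow> complex" and \<rho> :: real
  assumes F: "F holomorphic_on ball 0 1" and cnj: "\<And>w. F (cnj w) = cnj (F w)"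
    and \<rho>: "0 < \<rho>" "\<rho> < 1"
  shows "(\<integral>\<alpha>. Re (F (\<rho> * cis \<alpha>) / (\<rho> * cis \<alpha>) ^ k) \<partial>half_circle) = pi / fact k * Re ((deriv ^^ k) F 0)"
proof -
  define G where "G = (\<lambda>w. F w / w ^ k)"
  define g where "g = (\<lambda>\<alpha>. Re (G (\<rho> * cis \<alpha>)))"
  have contF: "continuous_on (ball 0 1) F"
    using F by (rule holomorphic_on_imp_continuous_on)
  have "((\<lambda>u. F u / (u - 0) ^ Suc k) has_contour_integral 2 * of_real pi * \<i> / fact k * (deriv ^^ k) F 0) (circlepath 0 \<rho>)"
    using Cauchy_has_contour_integral_higher_derivative_circlepath[of 0 \<rho> F 0 k]
      continuous_on_subset[OF contF, of "cball 0 \<rho>"] holomorphic_on_subset[OF F, of "ball 0 \<rho>"] \<rho>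
    by (simp add: subset_iff)
  then have "((\<lambda>t. F (\<rho> * cis t) / (\<rho> * cis t) ^ Suc k * \<rho> * \<i> * cis t) has_integral
      2 * of_real pi * \<i> / fact k * (deriv ^^ k) F 0) {0..2 * pi}"
    unfolding circlepath_def by (subst (asm) has_contour_integral_part_circlepath_iff) (auto simp: mult_ac)
  \<comment> \<open>The derivative of the path cancels one factor of the power \<open>Suc k\<close>.
    The remaining factor \<open>\<i>\<close> explains why imaginary parts are taken next.\<close>
  also have "(\<lambda>t. F (\<rho> * cis t) / (\<rho> * cis t) ^ Suc k * \<rho> * \<i> * cis t) = (\<lambda>t. \<i> * G (\<rho> * cis t))"
    using \<rho> by (auto simp: G_def)
  finally have "((\<lambda>t. Im (\<i> * G (\<rho> * cis t))) has_integral
      Im (2 * of_real pi * \<i> / fact k * (deriv ^^ k) F 0)) {0..2 * pi}"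
    by (rule has_integral_Im)
  also have "2 * of_real pi * \<i> / fact k * (deriv ^^ k) F 0 = of_real (2 * (pi / fact k)) * (\<i> * (deriv ^^ k) F 0)"
    by simp
  also have "Im \<dots> = 2 * (pi / fact k * Re ((deriv ^^ k) F 0))"
    by (simp only: times_complex.sel Re_complex_of_real Im_complex_of_real) simp
  finally have full: "(g has_integral 2 * (pi / fact k * Re ((deriv ^^ k) F 0))) {0..2 * pi}"
    by (simp add: g_def)
  have cont: "continuous_on A g" for A
    unfolding g_def G_def
    using \<rho> by (intro continuous_intros continuous_on_compose2[OF contF]) (auto simp: norm_mult)
  have g_reflect: "g (2 * pi - \<alpha>) = g \<alpha>" for \<alpha>
  proof -
    have "of_real \<rho> * cis (2 * pi - \<alpha>) = cnj (of_real \<rho> * cis \<alpha>)"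
      by (simp add: complex_eq_iff)
    then have "G (of_real \<rho> * cis (2 * pi - \<alpha>)) = cnj (G (of_real \<rho> * cis \<alpha>))"
      by (simp only: G_def cnj complex_cnj_power complex_cnj_divide)
    then show ?thesis
      by (simp add: g_def)
  qed
  define I where "I = integral {0..pi} g"
  have I: "(g has_integral I) {0..pi}"
    unfolding I_def by (intro integrable_integral integrable_continuous_real cont)
  \<comment> \<open>The reflection of the angle at \<open>pi\<close> carries the integral over
    \<open>{0..pi}\<close> to the one over \<open>{pi..2 * pi}\<close>.\<close>
  have "((\<lambda>x. g ((-1) *\<^sub>R x + 2 * pi)) has_integral (1 / \<bar>-1\<bar> ^ DIM(real)) *\<^sub>R I)
      ((\<lambda>x. (1 / (-1)) *\<^sub>R x + - ((1 / (-1)) *\<^sub>R (2 * pi))) ` cbox 0 pi)"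
    using I by (intro has_integral_affinity) auto
  then have "(g has_integral I) {pi..2 * pi}"
    by (simp add: g_reflect)
  with I have "(g has_integral (I + I)) {0..2 * pi}"
    by (intro has_integral_combine[of 0 pi]) auto
  then have "2 * (pi / fact k * Re ((deriv ^^ k) F 0)) = I + I"
    by (rule has_integral_unique[OF full])
  moreover have "(\<integral>\<alpha>. g \<alpha> \<partial>half_circle) = I"
    unfolding I_def integral_half_circle
    by (intro set_borel_integral_eq_integral borel_integrable_atLeastAtMost' cont)
  ultimately show ?thesis
    by (simp add: g_def G_def)
qed

section \<open>Passage to the boundary\<close>

text \<open>Boundedness in \<open>L\<^sup>p\<close> for some \<open>p > 1\<close> gives uniform integrability: cutting off at height \<open>m\<close>
  costs at most \<open>C m\<^bsup>1-p\<^esup>\<close>.\<close>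

lemma cutoff_error:
  fixes y m p :: real
  assumes "0 < m" "1 < p"
  shows "\<bar>y - max (-m) (min m y)\<bar> \<le> m powr (1 - p) * \<bar>y\<bar> powr p"
proof (cases "\<bar>y\<bar> \<le> m")
  case True
  then have "max (-m) (min m y) = y" by auto
  then show ?thesis by simp
next
  case False
  then have "\<bar>y - max (-m) (min m y)\<bar> \<le> \<bar>y\<bar>" using assms by auto
  also have "\<bar>y\<bar> = \<bar>y\<bar> powr (1 - p) * \<bar>y\<bar> powr p"
    using False assms by (simp flip: powr_add)
  also have "\<dots> \<le> m powr (1 - p) * \<bar>y\<bar> powr p"
    using False assms by (intro mult_right_mono powr_mono2') auto
  finally show ?thesis .
qed

lemma (in finite_measure) integrable_of_powr:
  fixes g :: "'a \<Rightarrow> real"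
  assumes [measurable]: "g \<in> borel_measurable M" and "1 < p"
    and "integrable M (\<lambda>x. \<bar>g x\<bar> powr p)"
  shows "integrable M g"
proof (rule Bochner_Integration.integrable_bound)
  show "integrable M (\<lambda>x. 1 + \<bar>g x\<bar> powr p)"
    using assms by auto
  \<comment> \<open>Cutting off at height 1 leaves a part of modulus at most 1, and the rest is
    bounded by the power.\<close>
  have "\<bar>y\<bar> \<le> 1 + \<bar>y\<bar> powr p" for y :: real
    using cutoff_error[of 1 p y] \<open>1 < p\<close> by auto
  then show "AE x in M. norm (g x) \<le> norm (1 + \<bar>g x\<bar> powr p)"
    by auto
qed simp

text \<open>Fatou's lemma hands the bound \<open>C\<close> on to the limit. Truncation at a large
  height \<open>m\<close> then changes all integrals by less than \<open>e / 3\<close>, uniformly in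
  \<open>n\<close>, and the truncated functions converge under the integral by dominated convergence
  with the constant \<open>m\<close>.\<close>

lemma (in finite_measure) tendsto_integral_of_powr_bound:
  fixes f :: "nat \<Rightarrow> 'a \<Rightarrow> real"
  assumes [measurable]: "\<And>n. f n \<in> borel_measurable M" "g \<in> borel_measurable M"
    and p: "1 < p"
    and int: "\<And>n. integrable M (\<lambda>x. \<bar>f n x\<bar> powr p)"
    and bound: "\<And>n. (\<integral>x. \<bar>f n x\<bar> powr p \<partial>M) \<le> C"
    and lim: "AE x in M. (\<lambda>n. f n x) \<longlonglongrightarrow> g x"
  shows "(\<lambda>n. integral\<^sup>L M (f n)) \<longlonglongrightarrow> integral\<^sup>L M g"
proof -
  have C: "0 \<le> C"
    by (rule order_trans[OF integral_nonneg_AE bound[of 0]]) auto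
  have "(\<integral>\<^sup>+x. ennreal (\<bar>g x\<bar> powr p) \<partial>M) = (\<integral>\<^sup>+x. liminf (\<lambda>n. ennreal (\<bar>f n x\<bar> powr p)) \<partial>M)"
  proof (rule nn_integral_cong_AE, use lim in eventually_elim)
    case (elim x)
    have "(\<lambda>n. \<bar>f n x\<bar> powr p) \<longlonglongrightarrow> \<bar>g x\<bar> powr p"
      using p elim by (intro tendsto_powr' tendsto_rabs) auto
    then show ?case
      by (intro lim_imp_Liminf[symmetric] tendsto_ennrealI) auto
  qed
  also have "\<dots> \<le> liminf (\<lambda>n. \<integral>\<^sup>+x. ennreal (\<bar>f n x\<bar> powr p) \<partial>M)"
    by (intro nn_integral_liminf) measurable
  also have "\<dots> \<le> ennreal C"
    using bound C by (intro Liminf_le always_eventually allI) (auto simp: nn_integral_eq_integral[OF int])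
  finally have nn: "(\<integral>\<^sup>+x. ennreal (\<bar>g x\<bar> powr p) \<partial>M) \<le> ennreal C" .
  have gint: "integrable M (\<lambda>x. \<bar>g x\<bar> powr p)"
    by (rule integrableI_bounded) (use nn in \<open>auto simp: le_less_trans[OF _ ennreal_less_top]\<close>)
  have gbound: "(\<integral>x. \<bar>g x\<bar> powr p \<partial>M) \<le> C"
    using nn C by (simp add: nn_integral_eq_integral[OF gint])
  define cut where "cut = (\<lambda>m y::real. max (-m) (min m y))"
  have cut_integral: "\<bar>integral\<^sup>L M k - (\<integral>x. cut m (k x) \<partial>M)\<bar> \<le> m powr (1 - p) * C"
    if [measurable]: "k \<in> borel_measurable M" and k: "integrable M (\<lambda>x. \<bar>k x\<bar> powr p)"
      "(\<integral>x. \<bar>k x\<bar> powr p \<partial>M) \<le> C" and "0 < m" for k m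
  proof -
    have 1: "integrable M k" by (rule integrable_of_powr) (use p k in auto)
    have 2: "integrable M (\<lambda>x. cut m (k x))"
      by (rule integrable_const_bound[of _ m]) (use \<open>0 < m\<close> in \<open>auto simp: cut_def\<close>)
    have "\<bar>integral\<^sup>L M k - (\<integral>x. cut m (k x) \<partial>M)\<bar> = \<bar>\<integral>x. k x - cut m (k x) \<partial>M\<bar>"
      using 1 2 by simp
    also have "\<dots> \<le> (\<integral>x. \<bar>k x - cut m (k x)\<bar> \<partial>M)"
      by (rule integral_abs_bound)
    also have "\<dots> \<le> (\<integral>x. m powr (1 - p) * \<bar>k x\<bar> powr p \<partial>M)"
      unfolding cut_def
      by (intro integral_mono integrable_abs Bochner_Integration.integrable_diff 1 integrable_mult_right k)
         (use 2 cutoff_error[OF \<open>0 < m\<close> p] in \<open>auto simp: cut_def\<close>)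
    also have "\<dots> = m powr (1 - p) * (\<integral>x. \<bar>k x\<bar> powr p \<partial>M)"
      by simp
    also have "\<dots> \<le> m powr (1 - p) * C"
      by (intro mult_left_mono k) auto
    finally show ?thesis .
  qed
  show ?thesis
  proof (rule tendstoI)
    fix e :: real assume "0 < e"
    have "((\<lambda>m. m powr (1 - p) * C) \<longlongrightarrow> 0) at_top"
      using p by (intro tendsto_mult_left_zero tendsto_neg_powr filterlim_ident) auto
    from order_tendstoD(2)[OF this, of "e / 3"] \<open>0 < e\<close>
    have "\<forall>\<^sub>F m in at_top. m powr (1 - p) * C < e / 3 \<and> 0 < m"
      by (intro eventually_conj eventually_gt_at_top) auto
    then obtain m where m: "m powr (1 - p) * C < e / 3" "0 < m"
      using eventually_happens'[of at_top] by (metis (mono_tags, lifting) trivial_limit_at_top_linorder)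
    have "(\<lambda>n. \<integral>x. cut m (f n x) \<partial>M) \<longlonglongrightarrow> (\<integral>x. cut m (g x) \<partial>M)"
    proof (rule integral_dominated_convergence[where w = "\<lambda>_. m"])
      show "AE x in M. (\<lambda>n. cut m (f n x)) \<longlonglongrightarrow> cut m (g x)"
        unfolding cut_def using lim by eventually_elim (intro tendsto_intros)
    qed (use m in \<open>auto simp: cut_def\<close>)
    from tendstoD[OF this, of "e / 3"] \<open>0 < e\<close>
    have "\<forall>\<^sub>F n in sequentially. dist (\<integral>x. cut m (f n x) \<partial>M) (\<integral>x. cut m (g x) \<partial>M) < e / 3"
      by simp
    then show "\<forall>\<^sub>F n in sequentially. dist (integral\<^sup>L M (f n)) (integral\<^sup>L M g) < e"
    proof eventually_elim
      case (elim n)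
      show ?case
        using elim m(1) cut_integral[OF assms(1) int bound m(2), of n] cut_integral[OF assms(2) gint gbound m(2)]
        unfolding dist_real_def by linarith
    qed
  qed
qed

section \<open>Radial approach to the unit circle\<close>

text \<open>The offset 2 keeps all radii, including that for \<open>n = 0\<close>, at least 1/2, so
  that division by \<open>(point n \<alpha>)^2\<close> stays uniformly bounded.\<close>

definition radius :: "nat \<Rightarrow> real" where
  "radius n = 1 - 1 / (real n + 2)"

lemma radius_bounds: "1 / 2 \<le> radius n" "0 < radius n" "radius n < 1"
  by (auto simp: radius_def field_simps)

lemma radius_tendsto: "radius \<longlonglongrightarrow> 1"
  unfolding radius_def by real_asymp

definition point :: "nat \<Rightarrow> real \<Rightarrow> complex" where
  "point n \<alpha> = of_real (radius n) * cis \<alpha>"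

lemma norm_point: "norm (point n \<alpha>) = radius n"
  using radius_bounds[of n] by (simp add: point_def norm_mult)

lemma point_tendsto: "(\<lambda>n. point n \<alpha>) \<longlonglongrightarrow> cis \<alpha>"
  unfolding point_def using radius_tendsto by (auto intro!: tendsto_eq_intros)

lemma continuous_on_point: "continuous_on A (point n)"
  unfolding point_def by (intro continuous_intros)

context bounded_slope
begin

lemma continuous_on_exponent_circle:
  assumes "0 \<le> \<rho>" "\<rho> < 1"
  shows "continuous_on A (\<lambda>\<alpha>. exponent h (of_real \<rho> * cis \<alpha>))"
  by (intro continuous_on_compose2[OF holomorphic_on_imp_continuous_on[OF exponent_holomorphic]] continuous_intros)
     (use assms in \<open>auto simp: norm_mult\<close>)

text \<open>Since \<open>\<bar>Im E\<bar>\<close> stays below \<open>c \<pi>/2\<close>, the power \<open>exp (p E)\<close> still has an argument bounded away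
  from \<open>\<pi>/2\<close> when \<open>p c < 1\<close>, so that its modulus is controlled by its real part, whose mean is 1.\<close>

lemma exp_exponent_powr_bound:
  "\<exists>p C. 1 < p \<and> (\<forall>\<rho>\<in>{0<..<1}.
      integrable half_circle (\<lambda>\<alpha>. norm (exp (exponent h (of_real \<rho> * cis \<alpha>))) powr p) \<and>
      (\<integral>\<alpha>. norm (exp (exponent h (of_real \<rho> * cis \<alpha>))) powr p \<partial>half_circle) \<le> C)"
proof -
  \<comment> \<open>Any exponent between 1 and \<open>1 / c\<close> would do; for this one both
    \<open>1 < p\<close> and \<open>p * c < 1\<close> reduce to \<open>c < 1\<close>.\<close>
  define p where "p = 2 / (1 + c)"
  have p: "1 < p" "p * c < 1"
    using bound_nonneg bound_less_1 by (auto simp: p_def field_simps)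
  \<comment> \<open>A lower bound for the cosine of the argument of \<open>exp (p E)\<close>. The
    resulting constant \<open>C = pi / k\<close> does not depend on the radius.\<close>
  define k where "k = cos (p * (c * pi / 2))"
  have angle: "0 \<le> p * (c * pi / 2)" "p * (c * pi / 2) < pi / 2"
    using p bound_nonneg mult_strict_right_mono[of "p * c" 1 "pi / 2"] by auto
  have k: "0 < k"
    unfolding k_def by (rule cos_gt_zero_pi) (use angle pi_gt_zero in linarith)+
  show ?thesis
  proof (intro exI conjI ballI)
    show "1 < p" by (rule p)
    fix \<rho> :: real assume "\<rho> \<in> {0<..<1}"
    then have \<rho>: "0 < \<rho>" "\<rho> < 1" by auto
    define F where "F = (\<lambda>w. exp (of_real p * exponent h w))"
    define n where "n = (\<lambda>\<alpha>. norm (exp (exponent h (of_real \<rho> * cis \<alpha>))) powr p)"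
    have n_eq: "n \<alpha> = exp (p * Re (exponent h (of_real \<rho> * cis \<alpha>)))" for \<alpha>
      by (simp add: n_def powr_def)
    show "integrable half_circle (\<lambda>\<alpha>. norm (exp (exponent h (of_real \<rho> * cis \<alpha>))) powr p)"
      unfolding n_def[symmetric] n_eq integrable_half_circle
      using \<rho> by (intro borel_integrable_atLeastAtMost' continuous_intros continuous_on_exponent_circle) auto
    then have int_n: "integrable half_circle n"
      by (simp add: n_def)
    have int_F: "integrable half_circle (\<lambda>\<alpha>. Re (F (of_real \<rho> * cis \<alpha>)))"
      unfolding F_def integrable_half_circle
      using \<rho> by (intro borel_integrable_atLeastAtMost' continuous_intros continuous_on_exponent_circle) auto
    have "(\<integral>\<alpha>. Re (F (of_real \<rho> * cis \<alpha>)) \<partial>half_circle) = pi"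
    proof -
      have "F holomorphic_on ball 0 1"
        unfolding F_def by (intro holomorphic_intros exponent_holomorphic)
      moreover have "F (cnj w) = cnj (F w)" for w
        by (simp add: F_def exponent_cnj exp_cnj)
      ultimately show ?thesis
        using half_circle_mean_value[of F \<rho> 0] \<rho> by (simp add: F_def exponent_0)
    qed
    moreover have "n \<alpha> \<le> Re (F (of_real \<rho> * cis \<alpha>)) / k" for \<alpha>
    proof -
      define E where "E = exponent h (of_real \<rho> * cis \<alpha>)"
      have "\<bar>Im E\<bar> \<le> c * pi / 2"
        unfolding E_def using \<rho> by (intro Im_exponent_bound) (simp add: norm_mult)
      then have "\<bar>p * Im E\<bar> \<le> p * (c * pi / 2)"
        using p by (simp add: abs_mult)
      then have "k \<le> cos \<bar>p * Im E\<bar>"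
        unfolding k_def using angle by (intro cos_monotone_0_pi_le) auto
      then have "exp (p * Re E) * k \<le> exp (p * Re E) * cos (p * Im E)"
        by (intro mult_left_mono) auto
      also have "\<dots> = Re (F (of_real \<rho> * cis \<alpha>))"
        by (simp add: F_def E_def Re_exp)
      finally show ?thesis
        using k by (simp add: n_eq E_def field_simps)
    qed
    then have "(\<integral>\<alpha>. n \<alpha> \<partial>half_circle) \<le> (\<integral>\<alpha>. Re (F (of_real \<rho> * cis \<alpha>)) / k \<partial>half_circle)"
      by (intro integral_mono int_n integrable_divide int_F) auto
    ultimately show "(\<integral>\<alpha>. norm (exp (exponent h (of_real \<rho> * cis \<alpha>))) powr p \<partial>half_circle) \<le> pi / k"
      unfolding n_def by simp
  qed
qed

text \<open>A bounded weight preserves the uniform bound on \<open>p\<close>-th powers. The weight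
  is 1 for the first identity and approximates the squared sine for the second.\<close>

lemma boundary_integral_tendsto:
  fixes W :: "nat \<Rightarrow> real \<Rightarrow> complex"
  assumes cont: "\<And>n. continuous_on {0..pi} (W n)"
    and bound: "\<And>n \<alpha>. norm (W n \<alpha>) \<le> B"
    and W: "\<And>\<alpha>. (\<lambda>n. W n \<alpha>) \<longlonglongrightarrow> W' \<alpha>"
    and [measurable]: "L \<in> borel_measurable half_circle" "W' \<in> borel_measurable half_circle"
    and L: "AE \<alpha> in half_circle. (\<lambda>n. exponent h (point n \<alpha>)) \<longlonglongrightarrow> L \<alpha>"
  shows "(\<lambda>n. \<integral>\<alpha>. Re (W n \<alpha> * exp (exponent h (point n \<alpha>))) \<partial>half_circle)
    \<longlonglongrightarrow> (\<integral>\<alpha>. Re (W' \<alpha> * exp (L \<alpha>)) \<partial>half_circle)"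
proof -
  obtain p C where p: "1 < p" and
    pC: "\<forall>\<rho>\<in>{0<..<1}.
      integrable half_circle (\<lambda>\<alpha>. norm (exp (exponent h (of_real \<rho> * cis \<alpha>))) powr p) \<and>
      (\<integral>\<alpha>. norm (exp (exponent h (of_real \<rho> * cis \<alpha>))) powr p \<partial>half_circle) \<le> C"
    using exp_exponent_powr_bound by blast
  have int: "integrable half_circle (\<lambda>\<alpha>. norm (exp (exponent h (point n \<alpha>))) powr p)" and
    C: "(\<integral>\<alpha>. norm (exp (exponent h (point n \<alpha>))) powr p \<partial>half_circle) \<le> C" for n
    using bspec[OF pC, of "radius n"] radius_bounds[of n] unfolding point_def by auto
  have B: "0 \<le> B"
    using bound[of 0 0] norm_ge_zero order_trans by blast
  define f where "f = (\<lambda>n \<alpha>. Re (W n \<alpha> * exp (exponent h (point n \<alpha>))))"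
  have [measurable]: "f n \<in> borel_measurable half_circle" for n
    unfolding f_def point_def using radius_bounds[of n]
    by (intro half_circle_continuous_measurable continuous_intros cont continuous_on_exponent_circle) auto
  have le: "\<bar>f n \<alpha>\<bar> powr p \<le> B powr p * norm (exp (exponent h (point n \<alpha>))) powr p" for n \<alpha>
  proof -
    have "\<bar>f n \<alpha>\<bar> \<le> norm (W n \<alpha>) * norm (exp (exponent h (point n \<alpha>)))"
      unfolding f_def norm_mult[symmetric] by (rule abs_Re_le_cmod)
    also have "\<dots> \<le> B * norm (exp (exponent h (point n \<alpha>)))"
      by (intro mult_right_mono bound) auto
    finally have "\<bar>f n \<alpha>\<bar> powr p \<le> (B * norm (exp (exponent h (point n \<alpha>)))) powr p"
      using p by (intro powr_mono2) auto
    then show ?thesis using B by (simp add: powr_mult)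
  qed
  have int': "integrable half_circle (\<lambda>\<alpha>. B powr p * norm (exp (exponent h (point n \<alpha>))) powr p)" for n
    using int by (intro integrable_mult_right)
  have fint: "integrable half_circle (\<lambda>\<alpha>. \<bar>f n \<alpha>\<bar> powr p)" for n
    by (rule Bochner_Integration.integrable_bound[OF int'[of n]]) (use le in auto)
  have "(\<lambda>n. integral\<^sup>L half_circle (f n)) \<longlonglongrightarrow> (\<integral>\<alpha>. Re (W' \<alpha> * exp (L \<alpha>)) \<partial>half_circle)"
  proof (rule half_circle.tendsto_integral_of_powr_bound[OF _ _ p fint])
    fix n
    have "(\<integral>\<alpha>. \<bar>f n \<alpha>\<bar> powr p \<partial>half_circle)
        \<le> (\<integral>\<alpha>. B powr p * norm (exp (exponent h (point n \<alpha>))) powr p \<partial>half_circle)"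
      by (intro integral_mono fint int' le)
    also have "\<dots> = B powr p * (\<integral>\<alpha>. norm (exp (exponent h (point n \<alpha>))) powr p \<partial>half_circle)"
      by simp
    also have "\<dots> \<le> B powr p * C"
      by (intro mult_left_mono C) auto
    finally show "(\<integral>\<alpha>. \<bar>f n \<alpha>\<bar> powr p \<partial>half_circle) \<le> B powr p * C" .
  next
    show "AE \<alpha> in half_circle. (\<lambda>n. f n \<alpha>) \<longlonglongrightarrow> Re (W' \<alpha> * exp (L \<alpha>))"
      using L by eventually_elim (auto simp: f_def intro!: tendsto_intros W)
  qed measurable
  then show ?thesis
    by (simp add: f_def)
qed

text \<open>At every radius the mean value property gives exactly \<open>pi\<close>, so the limit is
  that of a constant sequence.\<close>

lemma integral_exp_boundary:
  assumes "L \<in> borel_measurable half_circle"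
    and "AE \<alpha> in half_circle. (\<lambda>n. exponent h (point n \<alpha>)) \<longlonglongrightarrow> L \<alpha>"
  shows "(\<integral>\<alpha>. Re (exp (L \<alpha>)) \<partial>half_circle) = pi"
proof -
  have hol: "(\<lambda>w. exp (exponent h w)) holomorphic_on ball 0 1"
    by (intro holomorphic_intros exponent_holomorphic)
  have "(\<integral>\<alpha>. Re (1 * exp (exponent h (point n \<alpha>))) \<partial>half_circle) = pi" for n
    using half_circle_mean_value[OF hol _ radius_bounds(2,3), of n 0]
    by (simp add: exponent_cnj exp_cnj exponent_0 point_def)
  then have "(\<lambda>n. pi) \<longlonglongrightarrow> (\<integral>\<alpha>. Re (1 * exp (L \<alpha>)) \<partial>half_circle)"
    using boundary_integral_tendsto[of "\<lambda>_ _. 1" 1 "\<lambda>_. 1" L] assms by simp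
  then have "(\<integral>\<alpha>. Re (1 * exp (L \<alpha>)) \<partial>half_circle) = pi"
    by (rule LIMSEQ_unique[OF _ tendsto_const])
  then show ?thesis by simp
qed

text \<open>Stated for \<open>exp E\<close>. The variant with \<open>- E\<close> arises by passing
  to \<open>- h\<close>, which only flips the sign of the term with
  \<open>sine_coeff 2\<close>.\<close>

lemma exponent_second_coeff:
  "(deriv ^^ 2) (\<lambda>w. - (1 - w\<^sup>2)\<^sup>2 / 4 * exp (exponent h w)) 0 / 2 =
    of_real (1 / 2 - (sine_coeff 1)\<^sup>2 / 8 - sine_coeff 2 / 4)"
proof -
  define S where "S = Abs_fps (\<lambda>n. complex_of_real (sine_coeff n))"
  have S0: "fps_nth S 0 = 0"
    by (simp add: S_def sine_coeff_def)
  have S: "exponent h has_fps_expansion S"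
    unfolding S_def by (rule exponent_has_fps_expansion)
  have "(\<lambda>w. exp (exponent h w)) has_fps_expansion (fps_exp 1 oo S)"
    using has_fps_expansion_compose[OF has_fps_expansion_exp1 S S0] by (simp add: o_def)
  then have "(\<lambda>w. - (1 / 4) * (1 - 2 * w ^ 2 + w ^ 4) * exp (exponent h w)) has_fps_expansion
      fps_const (- (1 / 4)) * (1 - fps_const 2 * fps_X ^ 2 + fps_X ^ 4) * (fps_exp 1 oo S)"
    by (intro fps_expansion_intros)
  also have "(\<lambda>w. - (1 / 4) * (1 - 2 * w ^ 2 + w ^ 4) * exp (exponent h w)) =
      (\<lambda>w. - (1 - w\<^sup>2)\<^sup>2 / 4 * exp (exponent h w))"
    by (simp add: fun_eq_iff power2_eq_square power4_eq_xxxx field_simps)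
  finally have "(deriv ^^ 2) (\<lambda>w. - (1 - w\<^sup>2)\<^sup>2 / 4 * exp (exponent h w)) 0 / fact 2 =
      fps_nth (fps_const (- (1 / 4)) * (1 - fps_const 2 * fps_X ^ 2 + fps_X ^ 4) * (fps_exp 1 oo S)) 2"
    by (rule fps_nth_fps_expansion[symmetric])
  also have "\<dots> = - (1 / 4) * (fps_nth (fps_exp 1 oo S) 2 - 2 * fps_nth (fps_exp 1 oo S) 0)"
  proof -
    have "fps_const (- (1 / 4)) * (1 - fps_const 2 * fps_X ^ 2 + fps_X ^ 4) * G =
        fps_const (- (1 / 4)) * (G - fps_const 2 * (fps_X ^ 2 * G) + fps_X ^ 4 * G)" for G :: "complex fps"
      by (simp add: algebra_simps)
    then show ?thesis
      by (simp only: fps_mult_left_const_nth fps_add_nth fps_sub_nth fps_X_power_mult_nth) simp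
  qed
  also have "fps_nth (fps_exp 1 oo S) 0 = 1"
    by simp
  \<comment> \<open>Because \<open>S\<close> has no constant term, only the linear and quadratic
    terms of the exponential series reach degree 2.\<close>
  also have "fps_nth (fps_exp 1 oo S) 2 = fps_nth S 2 + (fps_nth S 1)\<^sup>2 / 2"
    using S0 by (simp add: fps_compose_nth numeral_2_eq_2 fps_mult_nth power2_eq_square)
  also have "- (1 / 4) * (fps_nth S 2 + (fps_nth S 1)\<^sup>2 / 2 - 2 * 1) =
      of_real (1 / 2 - (sine_coeff 1)\<^sup>2 / 8 - sine_coeff 2 / 4)"
    by (simp add: S_def field_simps)
  finally show ?thesis
    by (simp only: fact_2)
qed

text \<open>On the unit circle \<open>sin \<alpha>^2 = - (1 - w^2)^2 / (4 w^2)\<close> with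
  \<open>w = cis \<alpha>\<close>. Replacing \<open>w\<close> by a point inside the disc gives a
  holomorphic function divided by \<open>w^2\<close>, so the mean value formula with
  \<open>k = 2\<close> applies at each radius.\<close>

lemma integral_sin_square_exp_boundary:
  assumes "L \<in> borel_measurable half_circle"
    and "AE \<alpha> in half_circle. (\<lambda>n. exponent h (point n \<alpha>)) \<longlonglongrightarrow> L \<alpha>"
  shows "(\<integral>\<alpha>. (sin \<alpha>)\<^sup>2 * Re (exp (L \<alpha>)) \<partial>half_circle) =
    pi * (1 / 2 - (sine_coeff 1)\<^sup>2 / 8 - sine_coeff 2 / 4)"
proof -
  define F where "F = (\<lambda>w. - (1 - w\<^sup>2)\<^sup>2 / 4 * exp (exponent h w))"
  define W where "W = (\<lambda>n \<alpha>. - (1 - (point n \<alpha>)\<^sup>2)\<^sup>2 / 4 / (point n \<alpha>)\<^sup>2)"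
  have W: "(\<lambda>n. W n \<alpha>) \<longlonglongrightarrow> of_real ((sin \<alpha>)\<^sup>2)" for \<alpha>
  proof -
    have "1 - (cis \<alpha>)\<^sup>2 = cis \<alpha> * (- 2 * \<i> * sin \<alpha>)"
      by (simp add: complex_eq_iff power2_eq_square algebra_simps)
    then have "of_real ((sin \<alpha>)\<^sup>2) = - (1 - (cis \<alpha>)\<^sup>2)\<^sup>2 / 4 / (cis \<alpha>)\<^sup>2"
      by (simp add: power_mult_distrib)
    moreover have "(\<lambda>n. W n \<alpha>) \<longlonglongrightarrow> - (1 - (cis \<alpha>)\<^sup>2)\<^sup>2 / 4 / (cis \<alpha>)\<^sup>2"
      unfolding W_def by (intro tendsto_intros point_tendsto) auto
    ultimately show ?thesis by (simp only:)
  qed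
  \<comment> \<open>The numerator contributes at most \<open>2^2 / 4\<close>, and the radius is at
    least 1/2.\<close>
  have Wbound: "norm (W n \<alpha>) \<le> 4" for n \<alpha>
  proof -
    have "norm (1 - (point n \<alpha>)\<^sup>2) \<le> 1 + (radius n)\<^sup>2"
      using norm_triangle_ineq4[of 1 "(point n \<alpha>)\<^sup>2"] by (simp add: norm_power norm_point)
    also have "\<dots> \<le> 2"
      using radius_bounds[of n] by (simp add: power_le_one)
    finally have "(norm (1 - (point n \<alpha>)\<^sup>2))\<^sup>2 \<le> 2\<^sup>2"
      by (intro power_mono) auto
    moreover have "(1 / 2)\<^sup>2 \<le> (radius n)\<^sup>2"
      using radius_bounds[of n] by (intro power_mono) auto
    ultimately have "(norm (1 - (point n \<alpha>)\<^sup>2))\<^sup>2 / 4 / (radius n)\<^sup>2 \<le> (2\<^sup>2 / 4) / (1 / 2)\<^sup>2"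
      by (intro frac_le divide_right_mono) auto
    then show ?thesis
      unfolding W_def norm_divide norm_power norm_point norm_minus_cancel by (simp add: power_divide)
  qed
  have "(\<integral>\<alpha>. Re (W n \<alpha> * exp (exponent h (point n \<alpha>))) \<partial>half_circle) =
      pi * (1 / 2 - (sine_coeff 1)\<^sup>2 / 8 - sine_coeff 2 / 4)" for n
  proof -
    have "F holomorphic_on ball 0 1"
      unfolding F_def by (intro holomorphic_intros exponent_holomorphic) auto
    moreover have "F (cnj w) = cnj (F w)" for w
      by (simp add: F_def exponent_cnj exp_cnj)
    ultimately have "(\<integral>\<alpha>. Re (F (point n \<alpha>) / (point n \<alpha>) ^ 2) \<partial>half_circle) =
        pi * Re ((deriv ^^ 2) F 0 / 2)"
      using half_circle_mean_value[of F "radius n" 2] radius_bounds[of n] by (simp add: point_def)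
    then show ?thesis
      unfolding F_def exponent_second_coeff Re_complex_of_real by (simp add: W_def)
  qed
  moreover have "(\<lambda>n. \<integral>\<alpha>. Re (W n \<alpha> * exp (exponent h (point n \<alpha>))) \<partial>half_circle)
      \<longlonglongrightarrow> (\<integral>\<alpha>. Re (of_real ((sin \<alpha>)\<^sup>2) * exp (L \<alpha>)) \<partial>half_circle)"
  proof (rule boundary_integral_tendsto[OF _ Wbound W assms(1) _ assms(2)])
    fix n
    have "(point n \<alpha>)\<^sup>2 \<noteq> 0" for \<alpha>
      using norm_point[of n \<alpha>] radius_bounds(2)[of n] by auto
    then show "continuous_on {0..pi} (W n)"
      unfolding W_def by (intro continuous_intros continuous_on_point) auto
  qed measurable
  ultimately have "(\<lambda>n::nat. pi * (1 / 2 - (sine_coeff 1)\<^sup>2 / 8 - sine_coeff 2 / 4))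
      \<longlonglongrightarrow> (\<integral>\<alpha>. Re (of_real ((sin \<alpha>)\<^sup>2) * exp (L \<alpha>)) \<partial>half_circle)"
    by simp
  then have "(\<integral>\<alpha>. Re (of_real ((sin \<alpha>)\<^sup>2) * exp (L \<alpha>)) \<partial>half_circle) =
      pi * (1 / 2 - (sine_coeff 1)\<^sup>2 / 8 - sine_coeff 2 / 4)"
    by (rule LIMSEQ_unique[OF _ tendsto_const])
  then show ?thesis
    by (simp only: Re_complex_of_real times_complex.sel Im_complex_of_real) simp
qed

end

section \<open>Boundary values of the exponent\<close>

text \<open>Moving from \<rho> \<open>v\<close> to \<open>v\<close> costs \<open>1 - \<rho>\<close>,
  which is itself at most the distance from 1 to \<rho> \<open>v\<close>. Thus each factor of the
  kernel's denominator on the circle is controlled by its value inside.\<close>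

lemma norm_one_minus_le:
  fixes v :: complex
  assumes "norm v = 1" "0 \<le> \<rho>" "\<rho> \<le> 1"
  shows "norm (1 - v) \<le> 2 * norm (1 - of_real \<rho> * v)"
proof -
  have n: "norm (of_real \<rho> * v) = \<rho>"
    using assms by (simp add: norm_mult)
  have "norm (1 - v) \<le> norm (1 - of_real \<rho> * v) + norm (of_real \<rho> * v - v)"
    using norm_triangle_ineq[of "1 - of_real \<rho> * v" "of_real \<rho> * v - v"] by simp
  also have "of_real \<rho> * v - v = of_real (\<rho> - 1) * v"
    by (simp add: algebra_simps)
  also have "norm \<dots> = 1 - \<rho>"
    using assms by (simp add: norm_mult del: of_real_diff)
  also have "1 - \<rho> \<le> norm (1 - of_real \<rho> * v)"
    using norm_triangle_ineq2[of 1 "of_real \<rho> * v"] n by simp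
  finally show ?thesis by simp
qed

text \<open>Consequently the boundary value of \<open>kern\<close> is the real kernel
  \<open>sin \<beta> / (2 (cos \<alpha> - cos \<beta>))\<close>, whose only singularity for angles
  in \<open>{0..pi}\<close> is at \<beta> = \<alpha>.\<close>

lemma kern_denominator_cis:
  fixes \<alpha> \<beta> :: real
  shows "1 - 2 * cis \<alpha> * cos \<beta> + (cis \<alpha>)\<^sup>2 = 2 * cis \<alpha> * of_real (cos \<alpha> - cos \<beta>)"
proof -
  have "cis \<alpha> * (2 * of_real (cos \<alpha>)) = cis \<alpha> * (cis \<alpha> + cis (-\<alpha>))"
    by (simp add: complex_eq_iff)
  also have "\<dots> = (cis \<alpha>)\<^sup>2 + 1"
    by (simp add: distrib_left cis_mult power2_eq_square)
  finally show ?thesis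
    by (simp add: algebra_simps)
qed

text \<open>Two applications of \<open>norm_one_minus_le\<close> compare the denominators with
  factor 4. The right-hand side is independent of \<rho>, as dominated convergence requires; the
  product form also covers \<open>cos \<alpha> = cos \<beta>\<close>.\<close>

lemma norm_kern_le:
  assumes "0 \<le> \<rho>" "\<rho> < 1"
  shows "norm (kern \<beta> (of_real \<rho> * cis \<alpha>)) * \<bar>cos \<alpha> - cos \<beta>\<bar> \<le> 2 * \<bar>sin \<beta>\<bar>"
proof -
  define D where "D = (\<lambda>w::complex. 1 - 2 * w * of_real (cos \<beta>) + w\<^sup>2)"
  let ?w = "of_real \<rho> * cis \<alpha>"
  have "D ?w \<noteq> 0"
    unfolding D_def using assms by (intro kern_denominator_nonzero) (simp add: norm_mult)
  have "norm (1 - cis \<alpha> * cis \<gamma>) \<le> 2 * norm (1 - ?w * cis \<gamma>)" for \<gamma>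
    using norm_one_minus_le[of "cis \<alpha> * cis \<gamma>" \<rho>] assms by (simp add: norm_mult mult.assoc)
  then have "norm (D (cis \<alpha>)) \<le> (2 * norm (1 - ?w * cis \<beta>)) * (2 * norm (1 - ?w * cis (-\<beta>)))"
    unfolding D_def kern_denominator norm_mult[of "1 - _"] by (intro mult_mono) auto
  also have "\<dots> = 4 * norm (D ?w)"
    unfolding D_def kern_denominator norm_mult[of "1 - _"] by simp
  finally have "2 * \<bar>cos \<alpha> - cos \<beta>\<bar> \<le> 4 * norm (D ?w)"
    unfolding D_def kern_denominator_cis by (simp add: norm_mult del: of_real_diff)
  then have "norm (kern \<beta> ?w) * \<bar>cos \<alpha> - cos \<beta>\<bar> \<le> norm (kern \<beta> ?w) * (2 * norm (D ?w))"
    by (intro mult_left_mono) auto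
  moreover have "norm (kern \<beta> ?w) \<le> \<bar>sin \<beta>\<bar> / norm (D ?w)"
    unfolding kern_def D_def using assms
    by (auto simp: norm_mult norm_divide intro!: divide_right_mono mult_left_le_one_le)
  then have "norm (kern \<beta> ?w) * norm (D ?w) \<le> \<bar>sin \<beta>\<bar>"
    using \<open>D ?w \<noteq> 0\<close> by (simp add: field_simps)
  ultimately show ?thesis
    by linarith
qed

text \<open>The Cayley transform sends the open upper semicircle to the positive imaginary axis: the
  quotient is \<open>\<i> cot (\<alpha> / 2)\<close>, and
  \<open>sin \<alpha> / (1 - cos \<alpha>)\<close> is that cotangent. The imaginary part
  \<open>pi / 2\<close> produces the cosine factor of the identities.\<close>

lemma Ln_half_circle:
  assumes "0 < \<alpha>" "\<alpha> < pi"
  shows "(1 + cis \<alpha>) / (1 - cis \<alpha>) \<notin> \<real>\<^sub>\<le>\<^sub>0"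
    and "Ln ((1 + cis \<alpha>) / (1 - cis \<alpha>)) = of_real (ln (sin \<alpha> / (1 - cos \<alpha>))) + \<i> * of_real (pi / 2)"
    and "1 - cis \<alpha> \<noteq> 0"
proof -
  have "cos \<alpha> < 1"
    using assms cos_monotone_0_pi[of 0 \<alpha>] by simp
  then show ne: "1 - cis \<alpha> \<noteq> 0"
    by (auto simp: complex_eq_iff)
  have pos: "0 < sin \<alpha> / (1 - cos \<alpha>)"
    using assms \<open>cos \<alpha> < 1\<close> by (simp add: sin_gt_zero)
  have "(1 + cis \<alpha>) * of_real (1 - cos \<alpha>) = of_real (sin \<alpha>) * \<i> * (1 - cis \<alpha>)"
    using sin_cos_squared_add[of \<alpha>] by (simp add: complex_eq_iff algebra_simps power2_eq_square)
  then have eq: "(1 + cis \<alpha>) / (1 - cis \<alpha>) = of_real (sin \<alpha> / (1 - cos \<alpha>)) * \<i>"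
    using ne \<open>cos \<alpha> < 1\<close> by (simp add: field_simps)
  show "(1 + cis \<alpha>) / (1 - cis \<alpha>) \<notin> \<real>\<^sub>\<le>\<^sub>0"
    unfolding eq complex_nonpos_Reals_iff using pos by (simp del: divide_eq_0_iff)
  show "Ln ((1 + cis \<alpha>) / (1 - cis \<alpha>)) = of_real (ln (sin \<alpha> / (1 - cos \<alpha>))) + \<i> * of_real (pi / 2)"
    unfolding eq Ln_times_of_real[OF pos complex_i_not_zero] Ln_of_real[OF pos] Ln_ii by simp
qed

context bounded_slope
begin

text \<open>Subtracting the constant \<open>h \<alpha>\<close> removes the singularity of the
  limiting kernel. The constant is integrated explicitly by \<open>integral_kern\<close>; the
  remainder converges by dominated convergence.\<close>

lemma exponent_boundary:
  assumes \<alpha>: "0 < \<alpha>" "\<alpha> < pi"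
    and int: "integrable half_circle (\<lambda>\<beta>. (h \<beta> - h \<alpha>) * sin \<beta> / (cos \<alpha> - cos \<beta>))"
  shows "(\<lambda>n. exponent h (point n \<alpha>)) \<longlonglongrightarrow>
    of_real (1 / 2 * (\<integral>\<beta>. (h \<beta> - h \<alpha>) * sin \<beta> / (cos \<alpha> - cos \<beta>) \<partial>half_circle)) +
    of_real (h \<alpha>) * (of_real (ln (sin \<alpha> / (1 - cos \<alpha>))) + \<i> * of_real (pi / 2))"
proof -
  define k where "k = (\<lambda>\<beta>. (h \<beta> - h \<alpha>) * sin \<beta> / (cos \<alpha> - cos \<beta>))"
  have [measurable]: "k \<in> borel_measurable borel"
    unfolding k_def by measurable
  have split: "exponent h (point n \<alpha>) = (\<integral>\<beta>. of_real (h \<beta> - h \<alpha>) * kern \<beta> (point n \<alpha>) \<partial>half_circle) +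
      of_real (h \<alpha>) * Ln ((1 + point n \<alpha>) / (1 - point n \<alpha>))" for n
  proof -
    have p: "norm (point n \<alpha>) < 1"
      using radius_bounds[of n] by (simp add: norm_point)
    have "(\<integral>\<beta>. of_real (h \<beta>) * kern \<beta> (point n \<alpha>) - of_real (h \<alpha>) * kern \<beta> (point n \<alpha>) \<partial>half_circle) =
        exponent h (point n \<alpha>) - of_real (h \<alpha>) * (\<integral>\<beta>. kern \<beta> (point n \<alpha>) \<partial>half_circle)"
      unfolding exponent_def using half_circle_integrable_kern[OF p]
      by (subst Bochner_Integration.integral_diff) (auto intro: integrable_slope_times)
    then show ?thesis
      using integral_kern[OF p] by (simp add: algebra_simps)
  qed
  have "(\<lambda>n. \<integral>\<beta>. of_real (h \<beta> - h \<alpha>) * kern \<beta> (point n \<alpha>) \<partial>half_circle) \<longlonglongrightarrow>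
      (\<integral>\<beta>. of_real (k \<beta> / 2) \<partial>half_circle)"
  \<comment> \<open>The dominating function comes from \<open>norm_kern_le\<close>. At \<beta> =
    \<alpha> the factor \<open>h \<beta> - h \<alpha>\<close> makes every term zero.\<close>
  proof (rule integral_dominated_convergence[where w = "\<lambda>\<beta>. 2 * \<bar>k \<beta>\<bar>"])
    show "integrable half_circle (\<lambda>\<beta>. 2 * \<bar>k \<beta>\<bar>)"
      unfolding k_def by (intro integrable_mult_right integrable_abs int)
    have inj: "cos \<alpha> \<noteq> cos \<beta>" if "\<beta> \<in> {0..pi}" "\<beta> \<noteq> \<alpha>" for \<beta>
      using that \<alpha> cos_inj_pi[of \<alpha> \<beta>] by auto
    show "AE \<beta> in half_circle. (\<lambda>n. of_real (h \<beta> - h \<alpha>) * kern \<beta> (point n \<alpha>)) \<longlonglongrightarrow>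
        complex_of_real (k \<beta> / 2)"
    proof (rule AE_I2)
      fix \<beta> assume \<beta>: "\<beta> \<in> space half_circle"
      show "(\<lambda>n. of_real (h \<beta> - h \<alpha>) * kern \<beta> (point n \<alpha>)) \<longlonglongrightarrow> complex_of_real (k \<beta> / 2)"
      proof (cases "\<beta> = \<alpha>")
        case False
        then have ne: "1 - 2 * cis \<alpha> * of_real (cos \<beta>) + (cis \<alpha>)\<^sup>2 \<noteq> 0"
          using inj[of \<beta>] \<beta> unfolding kern_denominator_cis by (simp del: of_real_diff)
        have "(\<lambda>n. of_real (h \<beta> - h \<alpha>) * kern \<beta> (point n \<alpha>)) \<longlonglongrightarrow> of_real (h \<beta> - h \<alpha>) * kern \<beta> (cis \<alpha>)"
          unfolding kern_def by (intro tendsto_intros point_tendsto ne)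
        also have "of_real (h \<beta> - h \<alpha>) * kern \<beta> (cis \<alpha>) = complex_of_real (k \<beta> / 2)"
          using inj[of \<beta>] \<beta> False unfolding kern_def kern_denominator_cis k_def
          by (simp add: field_simps)
        finally show ?thesis .
      qed (simp add: k_def)
    qed
    show "AE \<beta> in half_circle. norm (of_real (h \<beta> - h \<alpha>) * kern \<beta> (point n \<alpha>)) \<le> 2 * \<bar>k \<beta>\<bar>" for n
    proof (rule AE_I2)
      fix \<beta> assume \<beta>: "\<beta> \<in> space half_circle"
      show "norm (of_real (h \<beta> - h \<alpha>) * kern \<beta> (point n \<alpha>)) \<le> 2 * \<bar>k \<beta>\<bar>"
      proof (cases "\<beta> = \<alpha>")
        case False
        then have "0 < \<bar>cos \<alpha> - cos \<beta>\<bar>"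
          using inj[of \<beta>] \<beta> by auto
        moreover have "norm (kern \<beta> (point n \<alpha>)) * \<bar>cos \<alpha> - cos \<beta>\<bar> \<le> 2 * \<bar>sin \<beta>\<bar>"
          unfolding point_def using radius_bounds[of n] by (intro norm_kern_le) auto
        ultimately have "norm (kern \<beta> (point n \<alpha>)) \<le> 2 * \<bar>sin \<beta>\<bar> / \<bar>cos \<alpha> - cos \<beta>\<bar>"
          by (simp add: field_simps)
        then have "\<bar>h \<beta> - h \<alpha>\<bar> * norm (kern \<beta> (point n \<alpha>)) \<le>
            \<bar>h \<beta> - h \<alpha>\<bar> * (2 * \<bar>sin \<beta>\<bar> / \<bar>cos \<alpha> - cos \<beta>\<bar>)"
          by (intro mult_left_mono) auto
        then show ?thesis
          by (simp add: k_def norm_mult abs_mult mult_ac del: of_real_diff)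
      qed (simp add: k_def)
    qed
  qed measurable
  moreover have "(\<lambda>n. of_real (h \<alpha>) * Ln ((1 + point n \<alpha>) / (1 - point n \<alpha>))) \<longlonglongrightarrow>
      of_real (h \<alpha>) * Ln ((1 + cis \<alpha>) / (1 - cis \<alpha>))"
    by (intro tendsto_intros point_tendsto Ln_half_circle \<alpha>)
  ultimately have "(\<lambda>n. exponent h (point n \<alpha>)) \<longlonglongrightarrow> (\<integral>\<beta>. complex_of_real (k \<beta> / 2) \<partial>half_circle) +
      of_real (h \<alpha>) * Ln ((1 + cis \<alpha>) / (1 - cis \<alpha>))"
    unfolding split by (rule tendsto_add)
  then show ?thesis
    unfolding Ln_half_circle(2)[OF \<alpha>] integral_complex_of_real by (simp add: k_def[symmetric])
qed

end

text \<open>The parametrisation of \<open>[a, b]\<close> by the boundary of the unit disc under the Joukowski map.\<close>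

definition chord :: "real \<Rightarrow> real \<Rightarrow> real \<Rightarrow> real" where
  "chord a b \<alpha> = (a + b) / 2 - (b - a) / 2 * cos \<alpha>"

lemma chord_ends: "chord a b 0 = a" "chord a b pi = b"
  by (simp_all add: chord_def field_simps)

lemma chord_measurable [measurable]: "chord a b \<in> borel_measurable borel"
  unfolding chord_def by measurable

lemma chord_deriv: "(chord a b has_real_derivative (b - a) / 2 * sin \<alpha>) (at \<alpha>)"
  unfolding chord_def by (auto intro!: derivative_eq_intros)

lemma chord_diffs:
  "chord a b \<alpha> - a = (b - a) / 2 * (1 - cos \<alpha>)"
  "b - chord a b \<alpha> = (b - a) / 2 * (1 + cos \<alpha>)"
  "chord a b \<beta> - chord a b \<alpha> = (b - a) / 2 * (cos \<alpha> - cos \<beta>)"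
  by (simp_all add: chord_def field_simps)

lemma chord_interior:
  assumes "a < b" "0 < \<alpha>" "\<alpha> < pi"
  shows "a < chord a b \<alpha>" "chord a b \<alpha> < b"
proof -
  have "cos \<alpha> < 1" "- 1 < cos \<alpha>"
    using assms cos_monotone_0_pi[of 0 \<alpha>] cos_monotone_0_pi[of \<alpha> pi] by auto
  then have "0 < (b - a) / 2 * (1 - cos \<alpha>)" "0 < (b - a) / 2 * (1 + cos \<alpha>)"
    using assms by (auto intro!: mult_pos_pos)
  then show "a < chord a b \<alpha>" "chord a b \<alpha> < b"
    unfolding chord_diffs[symmetric] by auto
qed

text \<open>Both sides are \<open>enn2real\<close> of one nonnegative integral, even when that is
  infinite. The integrands of the identities can thus be transported before they are known to be
  integrable.\<close>

lemma integral_chord_nonneg: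
  assumes "a \<le> b" and [measurable]: "f \<in> borel_measurable borel" and nn: "\<And>x. 0 \<le> f x"
  shows "(LBINT x:{a..b}. f x) = (\<integral>\<alpha>. f (chord a b \<alpha>) * ((b - a) / 2 * sin \<alpha>) \<partial>half_circle)"
proof -
  define g where "g = (\<lambda>\<alpha>. f (chord a b \<alpha>) * ((b - a) / 2 * sin \<alpha>))"
  have [measurable]: "g \<in> borel_measurable borel"
    unfolding g_def by measurable
  have sin: "0 \<le> (b - a) / 2 * sin \<alpha>" if "\<alpha> \<in> {0..pi}" for \<alpha>
    using that assms by (auto intro: mult_nonneg_nonneg sin_ge_zero)
  have "(LBINT x:{a..b}. f x) =
      enn2real (\<integral>\<^sup>+x. ennreal (f x * indicator {chord a b 0..chord a b pi} x) \<partial>lborel)"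
    unfolding set_lebesgue_integral_def chord_ends
    by (subst integral_eq_nn_integral) (auto simp: nn mult.commute)
  also have "(\<integral>\<^sup>+x. ennreal (f x * indicator {chord a b 0..chord a b pi} x) \<partial>lborel) =
      (\<integral>\<^sup>+\<alpha>. ennreal (f (chord a b \<alpha>) * ((b - a) / 2 * sin \<alpha>) * indicator {0..pi} \<alpha>) \<partial>lborel)"
    by (rule nn_integral_substitution[OF _ chord_deriv _ sin])
       (auto intro!: continuous_intros simp: set_borel_measurable_def)
  also have "enn2real \<dots> = (LBINT \<alpha>:{0..pi}. g \<alpha>)"
    unfolding set_lebesgue_integral_def
    by (subst integral_eq_nn_integral)
       (use sin nn in \<open>auto simp: g_def mult.commute indicator_def\<close>)
  finally show ?thesis
    by (simp add: integral_half_circle g_def)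
qed

lemma integral_chord:
  assumes "a \<le> b" and f: "set_integrable lborel {a..b} f"
  shows "integrable half_circle (\<lambda>\<alpha>. f (chord a b \<alpha>) * ((b - a) / 2 * sin \<alpha>))"
    and "(LBINT x:{a..b}. f x) = (\<integral>\<alpha>. f (chord a b \<alpha>) * ((b - a) / 2 * sin \<alpha>) \<partial>half_circle)"
proof -
  have sin: "0 \<le> (b - a) / 2 * sin \<alpha>" if "\<alpha> \<in> {0..pi}" for \<alpha>
    using that assms by (auto intro: mult_nonneg_nonneg sin_ge_zero)
  have cont: "continuous_on {0..pi} (\<lambda>\<alpha>. (b - a) / 2 * sin \<alpha>)"
    by (intro continuous_intros)
  have f': "set_integrable lborel {chord a b 0..chord a b pi} f"
    using f by (simp add: chord_ends)
  show "integrable half_circle (\<lambda>\<alpha>. f (chord a b \<alpha>) * ((b - a) / 2 * sin \<alpha>))"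
    unfolding integrable_half_circle using sin
    by (intro integral_substitution(1)[OF f' chord_deriv cont]) auto
  show "(LBINT x:{a..b}. f x) = (\<integral>\<alpha>. f (chord a b \<alpha>) * ((b - a) / 2 * sin \<alpha>) \<partial>half_circle)"
    using integral_substitution(2)[OF f' chord_deriv cont sin]
    by (simp add: integral_half_circle set_lebesgue_integral_def chord_ends mult.commute)
qed

text \<open>The quotient is bounded: near \<open>x\<close> by differentiability, by
  \<open>\<bar>D\<bar> + 1\<close>, and at distance at least \<open>d\<close> by
  \<open>2 * c / d\<close>. This makes the inner integral of the identities absolutely
  convergent.\<close>

lemma set_integrable_difference_quotient:
  fixes f :: "real \<Rightarrow> real"
  assumes "f \<in> borel_measurable borel" "\<And>u. \<bar>f u\<bar> \<le> c" "f differentiable (at x)"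
  shows "set_integrable lborel {a..b} (\<lambda>u. (f u - f x) / (u - x))"
proof -
  note assms(1)[measurable]
  have c: "0 \<le> c" using assms(2)[of 0] by linarith
  obtain D where D: "(f has_real_derivative D) (at x)"
    using assms(3) real_differentiable_def by blast
  then have "((\<lambda>u. (f u - f x) / (u - x)) \<longlongrightarrow> D) (at x)"
    by (simp add: has_field_derivative_iff)
  then have "\<forall>\<^sub>F u in at x. dist ((f u - f x) / (u - x)) D < 1"
    by (rule tendstoD) simp
  then obtain d where d: "0 < d" "\<And>u. u \<noteq> x \<Longrightarrow> dist u x < d \<Longrightarrow> dist ((f u - f x) / (u - x)) D < 1"
    unfolding eventually_at by auto
  have "\<bar>(f u - f x) / (u - x)\<bar> \<le> \<bar>D\<bar> + 1 + 2 * c / d" for u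
  proof (cases "\<bar>u - x\<bar> < d")
    case True
    have "\<bar>(f u - f x) / (u - x)\<bar> \<le> \<bar>D\<bar> + 1"
      using d(2)[of u] True by (cases "u = x") (auto simp: dist_real_def abs_if split: if_splits)
    then show ?thesis using c d(1) by (smt (verit) divide_nonneg_pos)
  next
    case False
    have "\<bar>f u - f x\<bar> \<le> 2 * c"
      using assms(2)[of u] assms(2)[of x] by linarith
    then have "\<bar>f u - f x\<bar> / \<bar>u - x\<bar> \<le> 2 * c / d"
      using False d(1) by (intro frac_le) auto
    then show ?thesis by simp
  qed
  then show ?thesis
    unfolding set_integrable_def
    by (intro integrableI_bounded_set_indicator[where B = "\<bar>D\<bar> + 1 + 2 * c / d"]) (auto simp: emeasure_lborel_Icc_eq)
qed

lemma set_integrable_bounded: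
  fixes f :: "real \<Rightarrow> real"
  assumes "f \<in> borel_measurable borel" "\<And>u. u \<in> {a..b} \<Longrightarrow> \<bar>f u\<bar> \<le> c"
  shows "set_integrable lborel {a..b} f"
  unfolding set_integrable_def using assms
  by (intro integrableI_bounded_set_indicator[where B = c]) (auto simp: emeasure_lborel_Icc_eq)

text \<open>Take logarithms and use
  \<open>(1 - cos \<alpha>) * (1 + cos \<alpha>) = sin \<alpha>^2\<close> to eliminate
  \<open>ln (1 + cos \<alpha>)\<close>. The result is the Jacobian of \<open>chord\<close> times the
  logarithmic part of the boundary exponent.\<close>

lemma powr_half_circle:
  assumes "0 < r" "0 < \<alpha>" "\<alpha> < pi"
  shows "(r * (1 - cos \<alpha>)) powr ((1 + t) / 2) * (r * (1 + cos \<alpha>)) powr ((1 - t) / 2) =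
    r * sin \<alpha> * exp (- (t * ln (sin \<alpha> / (1 - cos \<alpha>))))"
proof -
  define A B where "A = 1 - cos \<alpha>" and "B = 1 + cos \<alpha>"
  have c: "0 < A" "0 < B"
    unfolding A_def B_def
    using assms cos_monotone_0_pi[of 0 \<alpha>] cos_monotone_0_pi[of \<alpha> pi] by auto
  have s: "0 < sin \<alpha>" using assms by (intro sin_gt_zero)
  have "A * B = (sin \<alpha>)\<^sup>2"
    unfolding A_def B_def using sin_cos_squared_add[of \<alpha>] by (simp add: algebra_simps power2_eq_square)
  then have "ln A + ln B = ln ((sin \<alpha>)\<^sup>2)"
    using c by (simp only: ln_mult_pos[symmetric])
  also have "\<dots> = 2 * ln (sin \<alpha>)"
    using s by (simp add: ln_realpow)
  finally have lnB: "ln B = 2 * ln (sin \<alpha>) - ln A" by simp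
  have "(r * A) powr ((1 + t) / 2) * (r * B) powr ((1 - t) / 2) =
      exp ((1 + t) / 2 * (ln r + ln A) + (1 - t) / 2 * (ln r + ln B))"
    using c assms by (simp add: powr_def exp_add ln_mult_pos)
  also have "(1 + t) / 2 * (ln r + ln A) + (1 - t) / 2 * (ln r + ln B) =
      ln r + ln (sin \<alpha>) + - (t * (ln (sin \<alpha>) - ln A))"
    unfolding lnB by (simp add: field_simps)
  also have "ln (sin \<alpha>) - ln A = ln (sin \<alpha> / A)"
    using c s by (simp add: ln_div)
  also have "exp (ln r + ln (sin \<alpha>) + - (t * ln (sin \<alpha> / A))) = r * sin \<alpha> * exp (- (t * ln (sin \<alpha> / A)))"
    unfolding exp_add using s assms by simp
  finally show ?thesis
    unfolding A_def B_def .
qed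

section \<open>The two identities for a bounded slope differentiable off a finite set\<close>

text \<open>A finite Hilbert transform, regularised by subtracting the value at \<open>x\<close> so
  that no principal value is involved.\<close>

definition slope_transform :: "real \<Rightarrow> real \<Rightarrow> (real \<Rightarrow> real) \<Rightarrow> real \<Rightarrow> real" where
  "slope_transform a b \<phi> x = (LBINT u:{a..b}. (\<phi> u - \<phi> x) / (u - x))"

text \<open>The limit found in \<open>exponent_boundary\<close>, rewritten in the variable of
  \<open>[a, b]\<close>. Its imaginary part is \<open>pi / 2\<close> times the slope.\<close>

definition boundary_exponent :: "real \<Rightarrow> real \<Rightarrow> (real \<Rightarrow> real) \<Rightarrow> real \<Rightarrow> complex" where
  "boundary_exponent a b \<phi> \<alpha> = of_real (1 / 2 * slope_transform a b \<phi> (chord a b \<alpha>)) +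
    of_real (\<phi> (chord a b \<alpha>)) * (of_real (ln (sin \<alpha> / (1 - cos \<alpha>))) + \<i> * of_real (pi / 2))"

context
  fixes a b c :: real and \<phi> :: "real \<Rightarrow> real" and X :: "real set"
  assumes ab: "a < b" and \<phi>_measurable [measurable]: "\<phi> \<in> borel_measurable borel"
    and \<phi>_bound: "\<And>x. \<bar>\<phi> x\<bar> \<le> c" and c: "c < 1"
    and X: "finite X" and \<phi>_diff: "\<And>x. x \<in> {a<..<b} - X \<Longrightarrow> \<phi> differentiable (at x)"
begin

lemma slope_transform_measurable [measurable]: "slope_transform a b \<phi> \<in> borel_measurable borel"
  unfolding slope_transform_def set_lebesgue_integral_def by measurable

lemma boundary_exponent_measurable [measurable]: "boundary_exponent a b \<phi> \<in> borel_measurable borel"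
  unfolding boundary_exponent_def by measurable

lemma bounded_slope_chord: "bounded_slope (\<lambda>\<alpha>. \<phi> (chord a b \<alpha>)) c"
  by standard (use \<phi>_bound c in auto)

interpretation bounded_slope "\<lambda>\<alpha>. \<phi> (chord a b \<alpha>)" c
  by (rule bounded_slope_chord)

lemma exponent_tendsto_boundary:
  "AE \<alpha> in half_circle. (\<lambda>n. exponent (\<lambda>\<alpha>. \<phi> (chord a b \<alpha>)) (point n \<alpha>)) \<longlonglongrightarrow> boundary_exponent a b \<phi> \<alpha>"
proof -
  have inj: "inj_on (chord a b) {0..pi}"
    using ab by (auto simp: inj_on_def chord_def intro: cos_inj_pi)
  \<comment> \<open>The angles of the exceptional points: finite because \<open>chord\<close> is
    injective on \<open>{0..pi}\<close>, hence a null set.\<close>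
  define Y where "Y = chord a b -` X \<inter> {0..pi}"
  have "finite Y"
    unfolding Y_def by (intro finite_vimage_IntI X inj)
  then have "AE \<alpha> in lborel. \<alpha> \<notin> Y"
    by (intro AE_not_in finite_imp_null_set_lborel)
  then have "AE \<alpha> in half_circle. \<alpha> \<notin> Y"
    unfolding half_circle_def by (subst AE_restrict_space_iff) auto
  with AE_half_circle_interior show ?thesis
  proof eventually_elim
    case (elim \<alpha>)
    let ?x = "chord a b \<alpha>"
    have x: "?x \<in> {a<..<b} - X"
      using elim chord_interior[OF ab, of \<alpha>] by (auto simp: Y_def)
    \<comment> \<open>The half-length of the interval cancels between Jacobian and denominator. At
      \<beta> = \<alpha> both sides are 0 by the convention for division.\<close>
    have ker: "(\<phi> (chord a b \<beta>) - \<phi> ?x) / (chord a b \<beta> - ?x) * ((b - a) / 2 * sin \<beta>) =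
        (\<phi> (chord a b \<beta>) - \<phi> ?x) * sin \<beta> / (cos \<alpha> - cos \<beta>)" for \<beta>
    proof -
      have "p / (r * d) * (r * s) = p * s / d" if "r \<noteq> 0" for p r d s :: real
        using that by simp
      moreover have "(b - a) / 2 \<noteq> 0" using ab by simp
      ultimately show ?thesis unfolding chord_diffs by blast
    qed
    note si = set_integrable_difference_quotient[OF \<phi>_measurable \<phi>_bound \<phi>_diff[OF x], of a b]
    show ?case
      using integral_chord[OF less_imp_le[OF ab] si] elim
        exponent_boundary[of \<alpha>]
      unfolding ker boundary_exponent_def slope_transform_def by simp
  qed
qed

text \<open>Makes both integrands nonnegative, as \<open>integral_chord_nonneg\<close>
  demands.\<close>

lemma cos_slope_nonneg: "0 \<le> cos (pi * \<phi> x / 2)"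
proof (rule cos_ge_zero)
  have "- 1 \<le> \<phi> x" "\<phi> x \<le> 1" using \<phi>_bound[of x] c by linarith+
  then show "- (pi / 2) \<le> pi * \<phi> x / 2" "pi * \<phi> x / 2 \<le> pi / 2"
    using mult_left_mono[of "-1" "\<phi> x" pi] mult_left_mono[of "\<phi> x" 1 pi] by auto
qed

lemma powr_chord:
  assumes "0 < \<alpha>" "\<alpha> < pi"
  shows "(chord a b \<alpha> - a) powr ((1 + t) / 2) * (b - chord a b \<alpha>) powr ((1 - t) / 2) =
    (b - a) / 2 * sin \<alpha> * exp (- (t * ln (sin \<alpha> / (1 - cos \<alpha>))))"
  unfolding chord_diffs using ab assms by (intro powr_half_circle) auto

lemma powr_chord_minus:
  assumes "0 < \<alpha>" "\<alpha> < pi"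
  shows "(chord a b \<alpha> - a) powr (- ((1 + t) / 2)) * (b - chord a b \<alpha>) powr (- ((1 - t) / 2)) *
    ((b - a) / 2 * sin \<alpha>) = exp (t * ln (sin \<alpha> / (1 - cos \<alpha>)))"
proof -
  define q where "q = (b - a) / 2 * sin \<alpha>"
  have "0 < sin \<alpha>" using assms by (intro sin_gt_zero) auto
  then have q: "0 < q" using ab by (simp add: q_def)
  show ?thesis
    unfolding powr_minus inverse_mult_distrib[symmetric] powr_chord[OF assms] q_def[symmetric]
    using q by (simp add: exp_minus)
qed

lemma Re_exp_boundary:
  "Re (exp (boundary_exponent a b \<phi> \<alpha>)) = cos (pi * \<phi> (chord a b \<alpha>) / 2) *
    exp (\<phi> (chord a b \<alpha>) * ln (sin \<alpha> / (1 - cos \<alpha>))) * exp (1 / 2 * slope_transform a b \<phi> (chord a b \<alpha>))"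
  "Re (exp (- boundary_exponent a b \<phi> \<alpha>)) = cos (pi * \<phi> (chord a b \<alpha>) / 2) *
    exp (- (\<phi> (chord a b \<alpha>) * ln (sin \<alpha> / (1 - cos \<alpha>)))) * exp (- (1 / 2) * slope_transform a b \<phi> (chord a b \<alpha>))"
proof -
  have "Re (boundary_exponent a b \<phi> \<alpha>) = \<phi> (chord a b \<alpha>) * ln (sin \<alpha> / (1 - cos \<alpha>)) + 1 / 2 * slope_transform a b \<phi> (chord a b \<alpha>)"
    "Im (boundary_exponent a b \<phi> \<alpha>) = pi * \<phi> (chord a b \<alpha>) / 2"
    by (simp_all add: boundary_exponent_def)
  then show "Re (exp (boundary_exponent a b \<phi> \<alpha>)) = cos (pi * \<phi> (chord a b \<alpha>) / 2) *
      exp (\<phi> (chord a b \<alpha>) * ln (sin \<alpha> / (1 - cos \<alpha>))) * exp (1 / 2 * slope_transform a b \<phi> (chord a b \<alpha>))"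
    and "Re (exp (- boundary_exponent a b \<phi> \<alpha>)) = cos (pi * \<phi> (chord a b \<alpha>) / 2) *
      exp (- (\<phi> (chord a b \<alpha>) * ln (sin \<alpha> / (1 - cos \<alpha>)))) * exp (- (1 / 2) * slope_transform a b \<phi> (chord a b \<alpha>))"
    by (simp_all only: Re_exp uminus_complex.sel cos_minus exp_add minus_add_distrib mult_minus_left mult_ac)
qed

lemma first_identity:
  "(LBINT x:{a..b}. cos (pi * \<phi> x / 2) * (x - a) powr (- ((1 + \<phi> x) / 2))
      * (b - x) powr (- ((1 - \<phi> x) / 2)) * exp (1 / 2 * slope_transform a b \<phi> x)) = pi"
  (is "(LBINT x:{a..b}. ?f x) = _")
proof -
  have "(LBINT x:{a..b}. ?f x) = (\<integral>\<alpha>. ?f (chord a b \<alpha>) * ((b - a) / 2 * sin \<alpha>) \<partial>half_circle)"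
    using ab cos_slope_nonneg by (intro integral_chord_nonneg) auto
  also have "\<dots> = (\<integral>\<alpha>. Re (exp (boundary_exponent a b \<phi> \<alpha>)) \<partial>half_circle)"
  proof (rule integral_cong_AE)
    show "AE \<alpha> in half_circle. ?f (chord a b \<alpha>) * ((b - a) / 2 * sin \<alpha>) = Re (exp (boundary_exponent a b \<phi> \<alpha>))"
      using AE_half_circle_interior
    proof eventually_elim
      case (elim \<alpha>)
      then show ?case
        unfolding Re_exp_boundary powr_chord_minus[OF elim[THEN conjunct1] elim[THEN conjunct2], symmetric]
        by (simp only: mult_ac)
    qed
  qed measurable
  also have "\<dots> = pi"
    by (rule integral_exp_boundary[OF _ exponent_tendsto_boundary]) measurable
  finally show ?thesis .
qed

text \<open>Powers and Jacobian each contribute \<open>r sin \<alpha>\<close>, which yields the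
  weight \<open>r^2 sin \<alpha>^2\<close>. The two sine coefficients return to
  \<open>[a, b]\<close> as moments of the slope: \<open>r sin \<alpha> d\<alpha>\<close> is
  \<open>dx\<close>, and \<open>sin (2 \<alpha>)\<close> supplies the extra factor
  \<open>(a + b) / 2 - x\<close>.\<close>

lemma second_identity:
  "(LBINT x:{a..b}. 2 / pi * cos (pi * \<phi> x / 2) * (x - a) powr ((1 + \<phi> x) / 2)
      * (b - x) powr ((1 - \<phi> x) / 2) * exp (- (1 / 2) * slope_transform a b \<phi> x)) =
    ((b - a) / 2)\<^sup>2 - (LBINT x:{a..b}. \<phi> x)\<^sup>2 / 4 + (LBINT x:{a..b}. \<phi> x * ((a + b) / 2 - x))"
  (is "(LBINT x:{a..b}. ?f x) = _")
proof -
  define r where "r = (b - a) / 2"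
  \<comment> \<open>The exponential here carries the opposite sign, and \<open>- E\<close> is the
    exponent of the negated slope.\<close>
  interpret neg: bounded_slope "\<lambda>\<alpha>. - \<phi> (chord a b \<alpha>)" c
    by (rule bounded_slope_uminus)
  have neg_coeff: "neg.sine_coeff n = - sine_coeff n" for n
    by (simp add: neg.sine_coeff_def sine_coeff_def)
  have 1: "(LBINT x:{a..b}. \<phi> x) = r * sine_coeff 1"
  proof -
    have "(LBINT x:{a..b}. \<phi> x) = (\<integral>\<alpha>. \<phi> (chord a b \<alpha>) * ((b - a) / 2 * sin \<alpha>) \<partial>half_circle)"
      using ab by (intro integral_chord set_integrable_bounded[where c = c] \<phi>_measurable \<phi>_bound) auto
    also have "\<dots> = (\<integral>\<alpha>. r * (\<phi> (chord a b \<alpha>) * sin (real 1 * \<alpha>)) \<partial>half_circle)"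
      by (simp add: r_def mult_ac)
    finally show ?thesis
      by (simp only: sine_coeff_def integral_mult_right_zero)
  qed
  have 2: "(LBINT x:{a..b}. \<phi> x * ((a + b) / 2 - x)) = r\<^sup>2 / 2 * sine_coeff 2"
  proof -
    have "set_integrable lborel {a..b} (\<lambda>x. \<phi> x * ((a + b) / 2 - x))"
    proof (rule set_integrable_bounded[where c = "c * (b - a)"])
      fix u assume "u \<in> {a..b}"
      then show "\<bar>\<phi> u * ((a + b) / 2 - u)\<bar> \<le> c * (b - a)"
        unfolding abs_mult using bound_nonneg by (intro mult_mono \<phi>_bound) (auto simp: abs_le_iff field_simps)
    qed measurable
    then have "(LBINT x:{a..b}. \<phi> x * ((a + b) / 2 - x)) =
        (\<integral>\<alpha>. \<phi> (chord a b \<alpha>) * ((a + b) / 2 - chord a b \<alpha>) * ((b - a) / 2 * sin \<alpha>) \<partial>half_circle)"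
      using ab by (intro integral_chord) auto
    also have "\<dots> = (\<integral>\<alpha>. r\<^sup>2 / 2 * (\<phi> (chord a b \<alpha>) * sin (real 2 * \<alpha>)) \<partial>half_circle)"
    proof -
      have "(a + b) / 2 - chord a b \<alpha> = r * cos \<alpha>" for \<alpha>
        by (simp add: chord_def r_def)
      then have "\<phi> (chord a b \<alpha>) * ((a + b) / 2 - chord a b \<alpha>) * ((b - a) / 2 * sin \<alpha>) =
          r\<^sup>2 / 2 * (\<phi> (chord a b \<alpha>) * sin (real 2 * \<alpha>))" for \<alpha>
        by (simp add: r_def[symmetric] sin_double power2_eq_square)
      then show ?thesis by (simp only:)
    qed
    finally show ?thesis
      by (simp only: sine_coeff_def integral_mult_right_zero)
  qed
  have "(LBINT x:{a..b}. ?f x) = (\<integral>\<alpha>. ?f (chord a b \<alpha>) * ((b - a) / 2 * sin \<alpha>) \<partial>half_circle)"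
    using ab cos_slope_nonneg by (intro integral_chord_nonneg) auto
  also have "\<dots> = (\<integral>\<alpha>. 2 / pi * r\<^sup>2 * ((sin \<alpha>)\<^sup>2 * Re (exp (- boundary_exponent a b \<phi> \<alpha>))) \<partial>half_circle)"
  proof (rule integral_cong_AE)
    show "AE \<alpha> in half_circle. ?f (chord a b \<alpha>) * ((b - a) / 2 * sin \<alpha>) =
        2 / pi * r\<^sup>2 * ((sin \<alpha>)\<^sup>2 * Re (exp (- boundary_exponent a b \<phi> \<alpha>)))"
      using AE_half_circle_interior
    proof eventually_elim
      case (elim \<alpha>)
      define P Q T C where "P = (chord a b \<alpha> - a) powr ((1 + \<phi> (chord a b \<alpha>)) / 2)"
        and "Q = (b - chord a b \<alpha>) powr ((1 - \<phi> (chord a b \<alpha>)) / 2)"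
        and "T = exp (- (1 / 2) * slope_transform a b \<phi> (chord a b \<alpha>))"
        and "C = cos (pi * \<phi> (chord a b \<alpha>) / 2)"
      define E where "E = exp (- (\<phi> (chord a b \<alpha>) * ln (sin \<alpha> / (1 - cos \<alpha>))))"
      have "P * Q = r * sin \<alpha> * E"
        unfolding P_def Q_def E_def r_def using elim by (intro powr_chord) auto
      then have "2 / pi * C * (P * Q) * T * (r * sin \<alpha>) = 2 / pi * r\<^sup>2 * ((sin \<alpha>)\<^sup>2 * (C * E * T))"
        by (simp add: power2_eq_square)
      then show ?case
        unfolding Re_exp_boundary P_def Q_def E_def T_def C_def r_def[symmetric] by (simp only: mult_ac)
    qed
  qed measurable
  also have "\<dots> = 2 / pi * r\<^sup>2 * (pi * (1 / 2 - (sine_coeff 1)\<^sup>2 / 8 + sine_coeff 2 / 4))"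
  proof -
    have "AE \<alpha> in half_circle. (\<lambda>n. exponent (\<lambda>\<alpha>. - \<phi> (chord a b \<alpha>)) (point n \<alpha>)) \<longlonglongrightarrow> - boundary_exponent a b \<phi> \<alpha>"
      using exponent_tendsto_boundary by eventually_elim (simp add: exponent_uminus tendsto_minus)
    then have "(\<integral>\<alpha>. (sin \<alpha>)\<^sup>2 * Re (exp (- boundary_exponent a b \<phi> \<alpha>)) \<partial>half_circle) =
        pi * (1 / 2 - (neg.sine_coeff 1)\<^sup>2 / 8 - neg.sine_coeff 2 / 4)"
      by (intro neg.integral_sin_square_exp_boundary) measurable
    then show ?thesis
      unfolding integral_mult_right_zero by (simp add: neg_coeff)
  qed
  also have "\<dots> = r\<^sup>2 - (r * sine_coeff 1)\<^sup>2 / 4 + r\<^sup>2 / 2 * sine_coeff 2"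
    by (simp add: power_mult_distrib field_simps)
  finally show ?thesis
    unfolding 1 2 r_def .
qed

end

section \<open>Elementary integrals and the passage from diagrams to slopes\<close>

lemma integral_abs_diff:
  fixes a b z :: real
  assumes "a \<le> z" "z \<le> b"
  shows "(LBINT x:{a..b}. \<bar>x - z\<bar>) = ((z - a)\<^sup>2 + (b - z)\<^sup>2) / 2"
proof -
  have "((\<lambda>x. \<bar>x - z\<bar>) has_integral ((- ((z - z)\<^sup>2 / 2)) - (- ((a - z)\<^sup>2 / 2)))) {a..z}"
  proof (rule fundamental_theorem_of_calculus[OF assms(1)])
    fix x assume "x \<in> {a..z}"
    have "((\<lambda>x. - ((x - z)\<^sup>2 / 2)) has_real_derivative - (x - z)) (at x within {a..z})"
      by (auto intro!: derivative_eq_intros simp: field_simps)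
    then show "((\<lambda>x. - ((x - z)\<^sup>2 / 2)) has_vector_derivative \<bar>x - z\<bar>) (at x within {a..z})"
      using \<open>x \<in> {a..z}\<close> by (simp add: has_real_derivative_iff_has_vector_derivative)
  qed
  moreover have "((\<lambda>x. \<bar>x - z\<bar>) has_integral ((b - z)\<^sup>2 / 2 - (z - z)\<^sup>2 / 2)) {z..b}"
  proof (rule fundamental_theorem_of_calculus[OF assms(2)])
    fix x assume "x \<in> {z..b}"
    have "((\<lambda>x. (x - z)\<^sup>2 / 2) has_real_derivative x - z) (at x within {z..b})"
      by (auto intro!: derivative_eq_intros)
    then show "((\<lambda>x. (x - z)\<^sup>2 / 2) has_vector_derivative \<bar>x - z\<bar>) (at x within {z..b})"
      using \<open>x \<in> {z..b}\<close> by (simp add: has_real_derivative_iff_has_vector_derivative)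
  qed
  ultimately have "((\<lambda>x. \<bar>x - z\<bar>) has_integral (((- ((z - z)\<^sup>2 / 2)) - (- ((a - z)\<^sup>2 / 2))) +
      ((b - z)\<^sup>2 / 2 - (z - z)\<^sup>2 / 2))) {a..b}"
    by (rule has_integral_combine[OF assms])
  moreover have "(LBINT x:{a..b}. \<bar>x - z\<bar>) = integral {a..b} (\<lambda>x. \<bar>x - z\<bar>)"
    by (intro set_borel_integral_eq_integral borel_integrable_atLeastAtMost' continuous_intros)
  ultimately have "(LBINT x:{a..b}. \<bar>x - z\<bar>) =
      ((- ((z - z)\<^sup>2 / 2)) - (- ((a - z)\<^sup>2 / 2))) + ((b - z)\<^sup>2 / 2 - (z - z)\<^sup>2 / 2)"
    by (simp only: integral_unique)
  then show ?thesis
    by (simp add: power2_commute[of a z] add_divide_distrib)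
qed

text \<open>Lets \<open>deriv \<omega>\<close> be exchanged for the well-behaved \<phi> inside both
  the outer and the inner integrals.\<close>

lemma set_integral_discrete_difference:
  fixes f g :: "real \<Rightarrow> real"
  assumes "finite X" "\<And>x. x \<in> A \<Longrightarrow> x \<notin> X \<Longrightarrow> f x = g x"
  shows "(LBINT x:A. f x) = (LBINT x:A. g x)"
  unfolding set_lebesgue_integral_def
  by (rule integral_discrete_difference[of X]) (use assms in \<open>auto simp: countable_finite indicator_def\<close>)

text \<open>The fundamental theorem of calculus with finitely many exceptional points, for \<omega>
  itself and for the product \<open>\<omega> x * (m - x)\<close>; the latter amounts to integration
  by parts.\<close>

lemma integral_slope_moments:
  fixes a b :: real and \<omega> \<phi> :: "real \<Rightarrow> real"
  assumes ab: "a \<le> b" and cont: "continuous_on {a..b} \<omega>" and X: "finite X"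
    and deriv: "\<And>x. x \<in> {a<..<b} - X \<Longrightarrow> (\<omega> has_real_derivative \<phi> x) (at x)"
    and [measurable]: "\<phi> \<in> borel_measurable borel" and bound: "\<And>x. \<bar>\<phi> x\<bar> \<le> c"
  shows "(LBINT x:{a..b}. \<phi> x) = \<omega> b - \<omega> a"
    and "(LBINT x:{a..b}. \<phi> x * (m - x)) = \<omega> b * (m - b) - \<omega> a * (m - a) + (LBINT x:{a..b}. \<omega> x)"
proof -
  have int: "set_integrable lborel {a..b} \<phi>"
    by (rule set_integrable_bounded[where c = c]) (use bound in auto)
  have "(\<phi> has_integral \<omega> b - \<omega> a) {a..b}"
    using deriv by (intro fundamental_theorem_of_calculus_interior_strong[OF X ab _ cont])
      (auto simp: has_real_derivative_iff_has_vector_derivative)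
  then show "(LBINT x:{a..b}. \<phi> x) = \<omega> b - \<omega> a"
    using set_borel_integral_eq_integral(2)[OF int] by (simp add: integral_unique)
  have c: "0 \<le> c" using bound[of 0] by linarith
  have int1: "set_integrable lborel {a..b} (\<lambda>x. \<phi> x * (m - x))"
  proof (rule set_integrable_bounded[where c = "c * (\<bar>m\<bar> + \<bar>a\<bar> + \<bar>b\<bar>)"])
    fix u assume "u \<in> {a..b}"
    then show "\<bar>\<phi> u * (m - u)\<bar> \<le> c * (\<bar>m\<bar> + \<bar>a\<bar> + \<bar>b\<bar>)"
      unfolding abs_mult using c by (intro mult_mono bound) auto
  qed measurable
  have int2: "set_integrable lborel {a..b} \<omega>"
    by (rule borel_integrable_atLeastAtMost'[OF cont])
  have "((\<lambda>x. \<phi> x * (m - x) - \<omega> x) has_integral \<omega> b * (m - b) - \<omega> a * (m - a)) {a..b}"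
  proof (rule fundamental_theorem_of_calculus_interior_strong[OF X ab])
    fix x assume "x \<in> {a<..<b} - X"
    then have "((\<lambda>x. \<omega> x * (m - x)) has_real_derivative \<phi> x * (m - x) - \<omega> x) (at x)"
      by (auto intro!: derivative_eq_intros deriv)
    then show "((\<lambda>x. \<omega> x * (m - x)) has_vector_derivative \<phi> x * (m - x) - \<omega> x) (at x)"
      by (simp add: has_real_derivative_iff_has_vector_derivative)
  qed (intro continuous_intros cont)
  then have "(LBINT x:{a..b}. \<phi> x * (m - x) - \<omega> x) = \<omega> b * (m - b) - \<omega> a * (m - a)"
    using set_borel_integral_eq_integral(2)[OF set_integral_diff(1)[OF int1 int2]] by (simp add: integral_unique)
  then show "(LBINT x:{a..b}. \<phi> x * (m - x)) = \<omega> b * (m - b) - \<omega> a * (m - a) + (LBINT x:{a..b}. \<omega> x)"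
    using set_integral_diff(2)[OF int1 int2] by linarith
qed

text \<open>The slope is \<open>deriv \<omega>\<close> on the open set of regular points and 0
  elsewhere. The zero extension gives measurability and a bound on the whole line, independently of
  the values of \<open>deriv\<close> at breakpoints and outside the interval.\<close>

lemma smooth_diagram_slope:
  assumes "\<omega> \<in> smooth_diagrams a b"
  obtains X c \<phi> where "finite X" "c < 1" "\<phi> \<in> borel_measurable borel" "\<And>x. \<bar>\<phi> x\<bar> \<le> c"
    "\<And>x. x \<in> {a<..<b} - X \<Longrightarrow> \<phi> x = deriv \<omega> x"
    "\<And>x. x \<in> {a<..<b} - X \<Longrightarrow> \<phi> differentiable (at x)"
    "\<And>x. x \<in> {a<..<b} - X \<Longrightarrow> (\<omega> has_real_derivative \<phi> x) (at x)"
proof -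
  obtain X c1 c2 where X: "finite X" "C2_off a b X \<omega>"
    and c: "- 1 < c1" "c1 < c2" "c2 < 1"
    and slope: "\<And>x. x \<in> {a<..<b} \<Longrightarrow> \<omega> differentiable (at x) \<Longrightarrow> c1 < deriv \<omega> x \<and> deriv \<omega> x < c2"
    using assms unfolding smooth_diagrams_def by blast
  define U where "U = {a<..<b} - X"
  have "open U"
    unfolding U_def using X by (intro open_Diff finite_imp_closed) auto
  have diff: "\<omega> differentiable (at x)" "deriv \<omega> differentiable (at x)" if "x \<in> U" for x
    using X that unfolding C2_off_def U_def by auto
  define \<phi> where "\<phi> = (\<lambda>x. indicator U x *\<^sub>R deriv \<omega> x)"
  show ?thesis
  proof (rule that[of X "max \<bar>c1\<bar> \<bar>c2\<bar>" \<phi>])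
    show "max \<bar>c1\<bar> \<bar>c2\<bar> < 1" using c by auto
    show "\<phi> \<in> borel_measurable borel"
      unfolding \<phi>_def using \<open>open U\<close> diff
      by (intro borel_measurable_continuous_on_indicator)
         (auto intro!: continuous_at_imp_continuous_on differentiable_imp_continuous_within)
    show "\<bar>\<phi> x\<bar> \<le> max \<bar>c1\<bar> \<bar>c2\<bar>" for x
    proof (cases "x \<in> U")
      case True
      then have "c1 < deriv \<omega> x \<and> deriv \<omega> x < c2"
        using slope diff unfolding U_def by auto
      then show ?thesis using True by (auto simp: \<phi>_def)
    qed (simp add: \<phi>_def)
    fix x assume "x \<in> {a<..<b} - X"
    then have x: "x \<in> U" by (simp add: U_def)
    show eq: "\<phi> x = deriv \<omega> x" using x by (simp add: \<phi>_def)
    show "(\<omega> has_real_derivative \<phi> x) (at x)"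
      unfolding eq using diff[OF x] DERIV_deriv_iff_real_differentiable by blast
    obtain D where "(deriv \<omega> has_real_derivative D) (at x)"
      using diff[OF x] real_differentiable_def by blast
    then have "(\<phi> has_real_derivative D) (at x)"
      by (rule has_field_derivative_transform_within_open[OF _ \<open>open U\<close> x]) (simp add: \<phi>_def)
    then show "\<phi> differentiable (at x)"
      using real_differentiable_def by blast
  qed (rule X)
qed

theorem theorem2:
  fixes a b :: real and \<omega> :: "real \<Rightarrow> real"
  assumes "a < b" and "\<omega> \<in> smooth_diagrams a b"
  shows "(pi = (LBINT x:{a..b}.
           cos (pi * deriv \<omega> x / 2)
           * (x - a) powr (- ((1 + deriv \<omega> x) / 2))
           * (b - x) powr (- ((1 - deriv \<omega> x) / 2))
           * exp (1 / 2 * (LBINT u:{a..b}. (deriv \<omega> u - deriv \<omega> x) / (u - x))))) \<and>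
        ((LBINT x:{a..b}. \<omega> x - \<bar>x - diagram_center a \<omega>\<bar>) =
         (LBINT x:{a..b}.
           2 / pi * cos (pi * deriv \<omega> x / 2)
           * (x - a) powr ((1 + deriv \<omega> x) / 2)
           * (b - x) powr ((1 - deriv \<omega> x) / 2)
           * exp (- (1 / 2) * (LBINT u:{a..b}. (deriv \<omega> u - deriv \<omega> x) / (u - x)))))"
proof -
  obtain X c \<phi> where X: "finite X" and c: "c < 1" and meas: "\<phi> \<in> borel_measurable borel"
    and bound: "\<And>x. \<bar>\<phi> x\<bar> \<le> c" and eq: "\<And>x. x \<in> {a<..<b} - X \<Longrightarrow> \<phi> x = deriv \<omega> x"
    and diff: "\<And>x. x \<in> {a<..<b} - X \<Longrightarrow> \<phi> differentiable (at x)"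
    and deriv: "\<And>x. x \<in> {a<..<b} - X \<Longrightarrow> (\<omega> has_real_derivative \<phi> x) (at x)"
    using assms(2) by (rule smooth_diagram_slope) blast
  \<comment> \<open>The endpoints are added because \<phi> agrees with \<open>deriv \<omega>\<close>
    only at interior points.\<close>
  have fin: "finite (insert a (insert b X))" using X by simp
  have inner: "(LBINT u:{a..b}. (deriv \<omega> u - deriv \<omega> x) / (u - x)) = slope_transform a b \<phi> x"
    if "x \<in> {a<..<b} - X" for x
    unfolding slope_transform_def
    by (rule set_integral_discrete_difference[OF fin]) (use that eq in auto)
  have diag: "1-lipschitz_on {a..b} \<omega>" "a + \<omega> a = b - \<omega> b"
    using assms(2) unfolding smooth_diagrams_def diagram_def by auto
  have "(LBINT x:{a..b}.
           cos (pi * deriv \<omega> x / 2)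
           * (x - a) powr (- ((1 + deriv \<omega> x) / 2))
           * (b - x) powr (- ((1 - deriv \<omega> x) / 2))
           * exp (1 / 2 * (LBINT u:{a..b}. (deriv \<omega> u - deriv \<omega> x) / (u - x)))) = pi"
    by (rule trans[OF set_integral_discrete_difference[OF fin] first_identity[OF assms(1) meas bound c X diff]])
       (use inner eq in auto)
  moreover have "(LBINT x:{a..b}.
           2 / pi * cos (pi * deriv \<omega> x / 2)
           * (x - a) powr ((1 + deriv \<omega> x) / 2)
           * (b - x) powr ((1 - deriv \<omega> x) / 2)
           * exp (- (1 / 2) * (LBINT u:{a..b}. (deriv \<omega> u - deriv \<omega> x) / (u - x)))) =
      ((b - a) / 2)\<^sup>2 - (LBINT x:{a..b}. \<phi> x)\<^sup>2 / 4 + (LBINT x:{a..b}. \<phi> x * ((a + b) / 2 - x))"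
    by (rule trans[OF set_integral_discrete_difference[OF fin] second_identity[OF assms(1) meas bound c X diff]])
       (use inner eq in auto)
  moreover have "(LBINT x:{a..b}. \<omega> x - \<bar>x - diagram_center a \<omega>\<bar>) =
      ((b - a) / 2)\<^sup>2 - (LBINT x:{a..b}. \<phi> x)\<^sup>2 / 4 + (LBINT x:{a..b}. \<phi> x * ((a + b) / 2 - x))"
  proof -
    have cont: "continuous_on {a..b} \<omega>"
      using diag(1) by (rule lipschitz_on_continuous_on)
    \<comment> \<open>Together with \<open>\<omega> a + \<omega> b = b - a\<close> this forces
      \<open>\<omega> a\<close> and \<open>\<omega> b\<close> to be nonnegative, so the center lies
      in \<open>[a, b]\<close>.\<close>
    have "\<bar>\<omega> b - \<omega> a\<bar> \<le> b - a"
      using lipschitz_onD[OF diag(1), of b a] assms(1) by (auto simp: dist_real_def)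
    then have center: "a \<le> diagram_center a \<omega>" "diagram_center a \<omega> \<le> b"
      using diag(2) unfolding diagram_center_def by linarith+
    have ends: "\<omega> b = b - a - \<omega> a" using diag(2) by linarith
    have "(LBINT x:{a..b}. \<omega> x - \<bar>x - diagram_center a \<omega>\<bar>) =
        (LBINT x:{a..b}. \<omega> x) - (LBINT x:{a..b}. \<bar>x - diagram_center a \<omega>\<bar>)"
      by (intro set_integral_diff borel_integrable_atLeastAtMost' continuous_intros cont)
    also have "\<dots> = (LBINT x:{a..b}. \<omega> x) - ((\<omega> a)\<^sup>2 + (\<omega> b)\<^sup>2) / 2"
    proof -
      have "diagram_center a \<omega> - a = \<omega> a" "b - diagram_center a \<omega> = \<omega> b"
        using diag(2) unfolding diagram_center_def by linarith+
      then show ?thesis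
        unfolding integral_abs_diff[OF center] by (simp only:)
    qed
    \<comment> \<open>With \<open>\<omega> a + \<omega> b = b - a\<close>, the terms besides the
      integral of \<omega> sum to
      \<open>\<omega> a * \<omega> b - (\<omega> a + \<omega> b)^2 / 2\<close>, which is minus half
      the sum of the squares.\<close>
    also have "\<dots> = ((b - a) / 2)\<^sup>2 - (\<omega> b - \<omega> a)\<^sup>2 / 4 +
        (\<omega> b * ((a + b) / 2 - b) - \<omega> a * ((a + b) / 2 - a) + (LBINT x:{a..b}. \<omega> x))"
      unfolding ends by (simp add: power2_eq_square field_simps)
    also have "\<omega> b - \<omega> a = (LBINT x:{a..b}. \<phi> x)"
      using integral_slope_moments(1)[OF less_imp_le[OF assms(1)] cont X _ meas bound] deriv by simp
    also have "\<omega> b * ((a + b) / 2 - b) - \<omega> a * ((a + b) / 2 - a) + (LBINT x:{a..b}. \<omega> x) =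
        (LBINT x:{a..b}. \<phi> x * ((a + b) / 2 - x))"
      using integral_slope_moments(2)[OF less_imp_le[OF assms(1)] cont X _ meas bound] deriv by simp
    finally show ?thesis .
  qed
  ultimately show ?thesis by simp
qed

end
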